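(* Let $A,r$ be integers with $A\geq1$ and $r\geq2$. Let $f_i(X)=\sum_{n=0}^{\infty}t_i(n)X^n$ $(i=1,\ldots,r)$ be nonpolynomial power series with integral coefficients. Assume that $f_1(X),\ldots,f_r(X)$ satisfy the following four assumptions: 1. There exists a positive constant $C_7$ satisfying $0\leq t_i(n)\leq C_7$ for any $i=1,\ldots,r$ and any nonnegative integer $n$. 2. For any nonnegative integers $k_1,\ldots,k_r$ such that $k_1\leq A-1$ if $r=2$, and $k_1\leq A$ if $r\geq3$, we have $$R-\theta\left(R;\sum_{h=1}^{r-2}k_hS(f_h)+(1+k_{r-1})S(f_{r-1})\right)=o\left(\frac{R}{\prod_{h=1}^r\lambda(S(f_h);R)^{k_h}}\right)$$ as $R$ tends to infinity. 3. There exists a positive real number $\delta$ satisfying $\lambda(S(f_1);R)=o\left(R^{-\delta+1/A}\right)$ as $R$ tends to infinity. Moreover, for any $i=2,\ldots,r$ and any positive real number $\varepsilon$, we have $\lambda(S(f_i);R)=o\left(\lambda(S(f_{i-1});R)^{\varepsilon}\right)$ as $R$ tends to infinity. 4. There exist positive constants $C_8,C_9$ such that $[R,C_8R]\cap S(f_r)\neq\emptyset$ for any real number $R$ with $R\geq C_9$. Then, for any Pisot or Salem number $\beta$, the set $$\{f_1(\beta^{-1})^{k_1}f_2(\beta^{-1})^{k_2}\cdots f_r(\beta^{-1})^{k_r}\mid k_1,k_2,\ldots,k_r\in\mathbb{N},\ k_1\leq A\}$$ is linearly independent over $\mathbb{Q}(\beta)$.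
   Context: $\mathbb{N}$ is the set of nonnegative integers. A Pisot number is an algebraic integer greater than $1$ whose conjugates other than itself all have absolute value less than $1$. A Salem number is an algebraic integer greater than $1$ whose conjugates other than itself all have absolute value at most $1$, with at least one conjugate of absolute value exactly $1$. For a formal power series $f(X)=\sum_{n\ge0}t_nX^n$ put $S(f):=\{n\in\mathbb{N}\mid t_n\neq0\}$. For a nonempty set $\mathcal{A}\subset\mathbb{N}$ put $\lambda(\mathcal{A};R):=\mathrm{Card}(\mathcal{A}\cap[0,R))$ and, for a real number $R>\min\mathcal{A}$, $\theta(R;\mathcal{A}):=\max\{n\in\mathcal{A}\mid n<R\}$. For $k\in\mathbb{N}$, $kS(f)$ denotes the Minkowski sum: $0\,S(f):=\{0\}$ and $kS(f):=\{s_1+\cdots+s_k\mid s_1,\ldots,s_k\in S(f)\}$ for $k\geq1$. Sums of such sets are $\sum_{h}k_hS(f_h):=\{\sum_h s_h\mid s_h\in k_hS(f_h)\text{ for all }h\}$; the sum $\sum_{h=1}^{r-2}$ is absent when $r=2$. *)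

theory Defs
  imports
    "HOL-Analysis.Analysis"
    "HOL-Library.Set_Algebras"
    "HOL-Library.Landau_Symbols"
    "HOL-Computational_Algebra.Computational_Algebra"
begin

subsection \<open>Pisot and Salem numbers\<close>

text \<open>The conjugates of \<open>x\<close> are the complex roots of its minimal polynomial over the rationals;
  \<open>x\<close> itself is one of them. The set is empty if \<open>x\<close> is transcendental.\<close>

definition conjugates :: "real \<Rightarrow> complex set" where
  "conjugates x = {z. \<exists>p :: rat poly. lead_coeff p = 1 \<and> irreducible p \<and>
     poly (map_poly of_rat p) x = 0 \<and> poly (map_poly of_rat p) z = 0}"

definition Pisot :: "real \<Rightarrow> bool" where
  "Pisot \<beta> \<longleftrightarrow> algebraic_int \<beta> \<and> \<beta> > 1 \<and>
     (\<forall>z \<in> conjugates \<beta> - {of_real \<beta>}. cmod z < 1)"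

definition Salem :: "real \<Rightarrow> bool" where
  "Salem \<beta> \<longleftrightarrow> algebraic_int \<beta> \<and> \<beta> > 1 \<and>
     (\<forall>z \<in> conjugates \<beta> - {of_real \<beta>}. cmod z \<le> 1) \<and>
     (\<exists>z \<in> conjugates \<beta>. cmod z = 1)"


subsection \<open>Linear independence over \<open>\<rat>(\<beta>)\<close>\<close>

definition is_subfield :: "real set \<Rightarrow> bool" where
  "is_subfield K \<longleftrightarrow> 0 \<in> K \<and> 1 \<in> K \<and>
     (\<forall>x\<in>K. \<forall>y\<in>K. x + y \<in> K \<and> x * y \<in> K) \<and> (\<forall>x\<in>K. - x \<in> K \<and> inverse x \<in> K)"

text \<open>\<open>\<rat>(\<beta>)\<close> is the least subfield of the reals containing \<open>\<beta>\<close>.\<close>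

definition rat_adjoin :: "real \<Rightarrow> real set" where
  "rat_adjoin \<beta> = is_subfield hull {\<beta>}"

text \<open>The library's linear independence takes its scalars from a whole type, whereas here the
  scalars form a subset of the reals. Independence is that of an indexed family, so the vectors
  are in particular pairwise distinct.\<close>

definition lin_indep_family :: "real set \<Rightarrow> 'i set \<Rightarrow> ('i \<Rightarrow> real) \<Rightarrow> bool" where
  "lin_indep_family K I v \<longleftrightarrow>
     (\<forall>J c. finite J \<and> J \<subseteq> I \<and> (\<forall>j\<in>J. c j \<in> K) \<and> (\<Sum>j\<in>J. c j * v j) = 0
        \<longrightarrow> (\<forall>j\<in>J. c j = 0))"


subsection \<open>Supports, counting functions and sumsets\<close>

definition fps_supp :: "real fps \<Rightarrow> nat set" where
  "fps_supp f = {n. fps_nth f n \<noteq> 0}"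

definition count_below :: "nat set \<Rightarrow> real \<Rightarrow> nat" where
  "count_below A R = card {n \<in> A. real n < R}"

text \<open>Only meaningful for \<open>R > Min A\<close>; otherwise the maximum is over the empty set and
  unspecified.\<close>

definition last_below :: "real \<Rightarrow> nat set \<Rightarrow> nat" where
  "last_below R A = Max {n \<in> A. real n < R}"

text \<open>Addition and finite sums of sets are the elementwise operations of
  \<^theory>\<open>HOL-Library.Set_Algebras\<close>. In particular the empty sum is \<open>{0}\<close>.\<close>

definition sumset_power :: "nat \<Rightarrow> nat set \<Rightarrow> nat set" where
  "sumset_power k A = (\<Sum>j<k. A)"

lemma sumset_power_altdef: "sumset_power k A = {\<Sum>j<k. s j | s. \<forall>j<k. s j \<in> A}"
  unfolding sumset_power_def by (subst set_sum_alt) auto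

end

theory Submission
  imports Defs "Berlekamp_Zassenhaus.Factor_Bound" "HOL-Real_Asymp.Real_Asymp"
begin

text \<open>Suppose that a nontrivial relation holds; its coefficients may be taken in \<open>\<int>[\<beta>]\<close>. It says that a
  series \<open>\<Sum>w(m) \<beta>\<^sup>-\<^sup>m\<close> vanishes, where \<open>w\<close> is a combination of the coefficient sequences of the
  monomials in the \<open>f\<^sub>i\<close>. The remainders \<open>Y(m) = - \<Sum>\<^bsub>i\<le>m\<^esub> w(i) \<beta>\<^bsup>m-i\<^esup>\<close> lie in \<open>\<int>[\<beta>]\<close> and grow at most
  polynomially, as do their conjugates because \<open>\<beta>\<close> is Pisot or Salem. As the norm of a nonzero
  algebraic integer is at least 1, \<open>Y(m)\<close> is zero or at least an inverse power of \<open>m\<close>, and since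
  \<open>Y(m + 1) = \<beta> Y(m) - w(m + 1)\<close>, a nonzero remainder allows only a logarithmic run of zero digits.

  Let \<open>g\<close> be the lexicographically largest exponent of the relation, \<open>P\<close> the support of
  \<open>f\<^sub>1\<^bsup>g\<^sub>1\<^esup> \<cdots> f\<^bsub>r-1\<^esub>\<^bsup>g\<^bsub>r-1\<^esub>\<^esup>\<close> and \<open>G\<close> that of the leading monomial. The other monomials live on
  \<open>U\<^sub>1\<close>, where the exponent is smaller than \<open>g\<close> already before its last entry, or on
  \<open>U\<^sub>2 = \<Union>\<^bsub>j<g\<^sub>r\<^esub> (P + j S(f\<^sub>r))\<close>. Split \<open>[0, N)\<close> at the elements of \<open>U\<^sub>1 \<union> U\<^sub>2\<close>; in between, \<open>w \<ge> 0\<close>.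
  The gap after a point of \<open>U\<^sub>1\<close> is small because \<open>P \<subseteq> U\<^sub>2\<close> has small gaps. The gap after a point \<open>u\<close>
  of \<open>U\<^sub>2\<close> contains a point \<open>t\<close> of \<open>G\<close> with \<open>t - u\<close> comparable to its length, by the density of
  \<open>S(f\<^sub>r)\<close>; hence \<open>Y > 0\<close> on \<open>[u, t)\<close>, so nonzero digits, all at points of \<open>G\<close>, occur there in every
  window of logarithmic length. As \<open>U\<^sub>2\<close> and \<open>G\<close> have only \<open>O(N\<^bsup>1-d\<^esup>)\<close> elements below \<open>N\<close>, and the
  number of points of \<open>U\<^sub>1\<close> times the gap length allowed there is a small fraction of \<open>N\<close>, the gaps
  cannot add up to \<open>N\<close>.\<close>

subsection \<open>Norms of algebraic integers\<close>

text \<open>Pseudo-division multiplies the dividend by a power of the leading coefficient, which is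
  1 here.\<close>

lemma monic_of_int_division:
  fixes p Q :: "int poly"
  assumes "lead_coeff Q = 1" "degree Q > 0"
  obtains s t where "p = Q * s + t" "degree t < degree Q"
proof -
  obtain s t where st: "pseudo_divmod p Q = (s, t)" by force
  have Q0: "Q \<noteq> 0" using assms by auto
  from pseudo_divmod[OF Q0 st] assms show ?thesis
    by (intro that[of s t]) auto
qed

text \<open>Take a monic integer polynomial of least degree vanishing at \<open>x\<close>. If it
  split into integer factors of smaller degree, their leading coefficients would be units, so up to
  sign the factor vanishing at \<open>x\<close> would be monic and contradict minimality. Gauss's
  lemma carries irreducibility to the rationals.\<close>

lemma algebraic_int_minimal_polynomial:
  fixes x :: real
  assumes "algebraic_int x"
  obtains Q :: "int poly" where "lead_coeff Q = 1"
    "irreducible (of_int_poly Q :: rat poly)" "poly (of_int_poly Q) x = 0"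
proof -
  define P where "P n \<longleftrightarrow> (\<exists>Q :: int poly. lead_coeff Q = 1 \<and> degree Q = n \<and> poly (of_int_poly Q) x = 0)" for n
  have "\<exists>n. P n" using assms unfolding P_def algebraic_int_altdef_ipoly by auto
  then have "P (LEAST n. P n)" by (metis LeastI)
  then obtain Q :: "int poly" where Q: "lead_coeff Q = 1" "degree Q = (LEAST n. P n)" "poly (of_int_poly Q) x = 0"
    unfolding P_def by blast
  have min: "\<not> P n" if "n < degree Q" for n using that Q(2) not_less_Least by metis
  have deg: "degree Q > 0"
  proof (rule ccontr)
    assume "\<not> degree Q > 0"
    then have "degree Q = 0" by simp
    then obtain c where "Q = [:c:]" by (rule degree_eq_zeroE)
    with Q show False by simp
  qed
  have "irreducible\<^sub>d Q"
  proof (rule irreducible\<^sub>dI)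
    fix g h :: "int poly"
    assume d: "degree g < degree Q" "degree h < degree Q" and eq: "Q = g * h"
    have lc: "lead_coeff g * lead_coeff h = 1" using Q(1) unfolding eq lead_coeff_mult .
    have no: "poly (of_int_poly u) x \<noteq> 0" if u: "u dvd Q" "degree u < degree Q" "\<bar>lead_coeff u\<bar> = 1" for u :: "int poly"
    proof
      assume z: "poly (of_int_poly u) x = 0"
      define v where "v = Polynomial.smult (lead_coeff u) u"
      have "lead_coeff u * lead_coeff u = 1"
        using u(3) by (metis abs_mult_self_eq mult_1)
      then have "lead_coeff v = 1" unfolding v_def by (subst lead_coeff_smult) simp
      moreover have "degree v = degree u" using u(3) by (auto simp: v_def)
      moreover have "poly (of_int_poly v) x = 0" using z by (simp add: v_def hom_distribs)
      ultimately have "P (degree u)" unfolding P_def by blast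
      with min u(2) show False by blast
    qed
    have "\<bar>lead_coeff g\<bar> = 1" "\<bar>lead_coeff h\<bar> = 1"
      using lc by (auto simp: zmult_eq_1_iff)
    with no[of g] no[of h] d have "poly (of_int_poly g) x \<noteq> 0" "poly (of_int_poly h) x \<noteq> 0"
      using eq by auto
    moreover have "poly (of_int_poly g) x * poly (of_int_poly h) x = 0"
      using Q(3) unfolding eq by (simp add: hom_distribs)
    ultimately show False by simp
  qed (use deg in auto)
  then have "irreducible (of_int_poly Q :: rat poly)"
    using irreducible\<^sub>d_int_rat by (simp flip: irreducible_connect_field)
  with Q(1,3) show ?thesis using that by metis
qed

lemma poly_of_rat_of_int_poly:
  "poly (map_poly of_rat (of_int_poly p)) z = poly (of_int_poly p) (z :: 'a :: field_char_0)"
  by (subst map_poly_map_poly) (auto simp: o_def)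

lemma poly_of_rat_poly_mult:
  "poly (map_poly of_rat (p * q)) z = poly (map_poly of_rat p) z * poly (map_poly of_rat q) (z :: 'a :: field_char_0)"
proof -
  have "map_poly of_rat (p * q) = map_poly of_rat p * (map_poly of_rat q :: 'a poly)"
    by (intro poly_eqI) (simp add: coeff_map_poly coeff_mult of_rat_sum of_rat_mult)
  then show ?thesis by simp
qed

lemma irreducible_bezout:
  fixes Q p :: "rat poly"
  assumes "irreducible Q" "\<not> Q dvd p"
  obtains u v where "u * p + v * Q = 1"
proof -
  have "Rings.coprime Q p"
    using assms by (metis irreducible_imp_prime_elem_gcd prime_elem_imp_coprime)
  then have "gcd p Q = 1" by (metis coprime_iff_gcd_eq_1 gcd.commute)
  then show ?thesis
    using that bezout_coefficients_fst_snd[of p Q] by metis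
qed

text \<open>Bezout makes \<open>p\<close> invertible modulo \<open>Q\<close>, which excludes a
  common root in any field of characteristic 0. This carries nonvanishing from the real root to the
  complex ones.\<close>

lemma irreducible_nonvanishing:
  fixes Q p :: "rat poly" and x y :: "'a :: field_char_0" and z :: "'b :: field_char_0"
  assumes "irreducible Q" "poly (map_poly of_rat Q) x = 0" "poly (map_poly of_rat p) x \<noteq> 0"
    "poly (map_poly of_rat Q) z = 0"
  shows "poly (map_poly of_rat p) z \<noteq> 0"
proof
  assume pz: "poly (map_poly of_rat p) z = 0"
  have "\<not> Q dvd p"
  proof
    assume "Q dvd p"
    then obtain s where "p = Q * s" by (auto simp: dvd_def)
    with assms show False by (simp add: poly_of_rat_poly_mult)
  qed
  then obtain u v where "u * p + v * Q = 1"
    using irreducible_bezout assms by metis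
  then have "poly (map_poly of_rat (u * p + v * Q)) z = (1::'b)"
    by simp
  with pz assms show False by (simp add: hom_distribs poly_of_rat_poly_mult)
qed

text \<open>In characteristic 0 an irreducible polynomial is coprime to its derivative, so its
  complex roots are simple.\<close>

lemma card_roots_irreducible:
  fixes Q :: "int poly"
  assumes "irreducible (of_int_poly Q :: rat poly)"
  shows "card {z :: complex. poly (of_int_poly Q) z = 0} = degree Q"
proof -
  let ?Q = "of_int_poly Q :: rat poly" and ?C = "of_int_poly Q :: complex poly"
  have Q0: "Q \<noteq> 0" using assms by auto
  have d: "degree ?Q > 0" using assms irreducible_connect_field[of ?Q] irreducible\<^sub>dD by auto
  have "\<not> ?Q dvd pderiv ?Q"
  proof
    assume "?Q dvd pderiv ?Q"
    then have "degree ?Q \<le> degree (pderiv ?Q) \<or> pderiv ?Q = 0"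
      by (metis dvd_imp_degree_le)
    moreover have "pderiv ?Q \<noteq> 0" using d by (simp add: pderiv_eq_0_iff)
    ultimately show False using d by (simp add: degree_pderiv)
  qed
  then obtain u v where uv: "u * pderiv ?Q + v * ?Q = 1"
    using irreducible_bezout assms by metis
  have "rsquarefree ?C"
    unfolding rsquarefree_roots
  proof (intro allI notI)
    fix a assume a: "poly ?C a = 0 \<and> poly (pderiv ?C) a = 0"
    have m: "map_poly of_rat ?Q = ?C"
      by (simp add: map_poly_map_poly o_def)
    have "poly (map_poly of_rat (u * pderiv ?Q + v * ?Q)) a = 1"
      unfolding uv by simp
    with a show False by (simp add: poly_of_rat_poly_mult hom_distribs m)
  qed
  moreover have "?C \<noteq> 0" using Q0 by simp
  ultimately show ?thesis using rsquarefree_card_degree[of ?C] by simp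
qed

text \<open>The product is the determinant of multiplication by \<open>p\<close> on Z[X]/(Q). In the
  basis of powers of X this map has an integer matrix, and the Vandermonde matrix of the roots
  diagonalizes it over the complex numbers.\<close>

lemma conjugate_product_integer:
  fixes Q p :: "int poly"
  assumes monic: "lead_coeff Q = 1" and irr: "irreducible (of_int_poly Q :: rat poly)"
  shows "(\<Prod>z | poly (of_int_poly Q) z = 0. poly (of_int_poly p) z) \<in> (\<int> :: complex set)"
proof -
  define d where "d = degree Q"
  define Z where "Z = {z :: complex. poly (of_int_poly Q) z = 0}"
  have dpos: "d > 0" using irr irreducible_connect_field[of "of_int_poly Q :: rat poly"] irreducible\<^sub>dD
    unfolding d_def by auto
  have cardZ: "card Z = d" using card_roots_irreducible[OF irr] unfolding Z_def d_def .
  have finZ: "finite Z" using cardZ dpos card_ge_0_finite by auto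
  obtain zs where zs: "bij_betw zs {..<d} Z"
    using ex_bij_betw_nat_finite[OF finZ] cardZ by (metis atLeast0LessThan)
  have root: "poly (of_int_poly Q) (zs l) = 0" if "l < d" for l
    using zs that unfolding Z_def bij_betw_def by auto
  \<comment> \<open>The remainder of X^i * p modulo \<open>Q\<close> supplies row \<open>i\<close>
    of the matrix; it is integral because \<open>Q\<close> is monic.\<close>
  have "\<exists>t. degree t < d \<and> (\<exists>s. Polynomial.monom 1 i * p = Q * s + t)" for i
    using monic_of_int_division[OF monic, of "Polynomial.monom 1 i * p"] dpos unfolding d_def by metis
  then obtain t where t: "\<And>i. degree (t i) < d" "\<And>i. \<exists>s. Polynomial.monom 1 i * p = Q * s + t i"
    by metis
  have t_eval: "poly (of_int_poly (t i)) (zs l) = zs l ^ i * poly (of_int_poly p) (zs l)" if "l < d" for i l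
  proof -
    obtain s where "Polynomial.monom 1 i * p = Q * s + t i" using t(2) by blast
    then have "poly (of_int_poly (Polynomial.monom 1 i * p)) (zs l) = poly (of_int_poly (Q * s + t i)) (zs l)" by simp
    then show ?thesis using root[OF that]
      by (simp add: hom_distribs poly_of_rat_poly_mult poly_monom)
  qed
  define M where "M = mat d d (\<lambda>(i, j). Polynomial.coeff (t i) j)"
  define V where "V = mat d d (\<lambda>(j, l). zs l ^ j)"
  define D where "D = mat d d (\<lambda>(i, j). if i = j then poly (of_int_poly p) (zs i) else 0)"
  let ?M = "map_mat of_int M :: complex mat"
  have car: "?M \<in> carrier_mat d d" "V \<in> carrier_mat d d" "D \<in> carrier_mat d d"
    by (auto simp: M_def V_def D_def)
  \<comment> \<open>Column \<open>l\<close> of \<open>V\<close> is an eigenvector of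
    \<open>?M\<close> whose eigenvalue is the value of \<open>p\<close> at \<open>zs l\<close>:
    evaluation at a root kills the multiple of \<open>Q\<close>.\<close>
  have "?M * V = V * D"
  proof (rule eq_matI)
    fix i l assume "i < dim_row (V * D)" "l < dim_col (V * D)"
    then have il: "i < d" "l < d" using car by auto
    have "(?M * V) $$ (i, l) = (\<Sum>j<d. of_int (Polynomial.coeff (t i) j) * zs l ^ j)"
      using il by (simp add: M_def V_def scalar_prod_def atLeast0LessThan)
    also have "\<dots> = poly (of_int_poly (t i)) (zs l)"
    proof -
      have "poly (of_int_poly (t i)) (zs l) = (\<Sum>j\<le>degree (t i). of_int (Polynomial.coeff (t i) j) * zs l ^ j)"
        by (simp add: poly_altdef)
      also have "\<dots> = (\<Sum>j<d. of_int (Polynomial.coeff (t i) j) * zs l ^ j)"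
        using t(1)[of i] by (intro sum.mono_neutral_left) (auto simp: coeff_eq_0)
      finally show ?thesis by simp
    qed
    also have "\<dots> = zs l ^ i * poly (of_int_poly p) (zs l)" by (rule t_eval[OF il(2)])
    also have "\<dots> = (\<Sum>j<d. zs j ^ i * (if j = l then poly (of_int_poly p) (zs j) else 0))"
      using il by (simp add: if_distrib cong: if_cong)
    also have "\<dots> = (V * D) $$ (i, l)"
      using il by (simp add: D_def V_def scalar_prod_def atLeast0LessThan)
    finally show "(?M * V) $$ (i, l) = (V * D) $$ (i, l)" .
  qed (auto simp: M_def V_def D_def)
  then have "Determinant.det ?M * Determinant.det V = Determinant.det V * Determinant.det D"
    using car by (metis det_mult)
  \<comment> \<open>A kernel vector of the transposed Vandermonde matrix lists the coefficients of a
    polynomial of degree below \<open>d\<close> with \<open>d\<close> distinct roots.\<close>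
  moreover have "Determinant.det V \<noteq> 0"
  proof
    assume "Determinant.det V = 0"
    then have "Determinant.det (transpose_mat V) = 0" using car(2) by (simp add: det_transpose)
    then obtain v where v: "v \<in> carrier_vec d" "v \<noteq> 0\<^sub>v d" "transpose_mat V *\<^sub>v v = 0\<^sub>v d"
      using det_0_iff_vec_prod_zero_field[of "transpose_mat V" d] car(2) by auto
    define q where "q = (\<Sum>j<d. Polynomial.monom (v $ j) j)"
    have cq: "Polynomial.coeff q j = (if j < d then v $ j else 0)" for j
      by (simp add: q_def coeff_sum)
    have "q = 0"
    proof (rule ccontr)
      assume q0: "q \<noteq> 0"
      have "degree q < d" 
        using degree_le[of "d - 1" q] cq dpos by fastforce
      moreover have "card {z. poly q z = 0} \<le> degree q" by (rule card_poly_roots_bound[OF q0])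
      moreover have "Z \<subseteq> {z. poly q z = 0}"
      proof
        fix z assume "z \<in> Z"
        then obtain l where l: "l < d" "z = zs l" using zs unfolding bij_betw_def by auto
        have "poly q z = (\<Sum>j<d. v $ j * z ^ j)" by (simp add: q_def poly_sum poly_monom)
        also have "\<dots> = (transpose_mat V *\<^sub>v v) $ l"
          using l v(1) car by (simp add: scalar_prod_def V_def atLeast0LessThan mult.commute)
        also have "\<dots> = 0" using v(3) l by simp
        finally show "z \<in> {z. poly q z = 0}" by simp
      qed
      then have "d \<le> card {z. poly q z = 0}"
        using card_mono[OF poly_roots_finite[OF q0]] cardZ by auto
      ultimately show False by simp
    qed
    then have "v = 0\<^sub>v d" using v(1) cq by (intro eq_vecI) (auto, metis coeff_0)
    with v(2) show False by simp
  qed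
  ultimately have "Determinant.det D = Determinant.det ?M" by simp
  also have "\<dots> = of_int (Determinant.det M)" by (rule of_int_hom.hom_det)
  finally have "Determinant.det D \<in> \<int>" by simp
  moreover have "Determinant.det D = (\<Prod>i<d. poly (of_int_poly p) (zs i))"
  proof -
    have "Determinant.det D = prod_list (diag_mat D)"
      by (rule det_upper_triangular[OF _ car(3)]) (auto simp: D_def upper_triangular_def)
    also have "diag_mat D = map (\<lambda>i. poly (of_int_poly p) (zs i)) [0..<d]"
      by (auto simp: diag_mat_def D_def)
    finally show ?thesis by (simp add: prod.distinct_set_conv_list[symmetric] atLeast0LessThan)
  qed
  moreover have "(\<Prod>i<d. poly (of_int_poly p) (zs i)) = (\<Prod>z\<in>Z. poly (of_int_poly p) z)"
    by (rule prod.reindex_bij_betw[OF zs])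
  ultimately show ?thesis by (simp add: Z_def)
qed

text \<open>The product of the values of \<open>p\<close> at all roots of \<open>Q\<close> is a
  nonzero integer, hence at least 1 in absolute value; every factor except the one at
  \<open>x\<close> is bounded by \<open>B\<close>.\<close>

lemma norm_lower_bound:
  fixes Q p :: "int poly" and x B :: real
  assumes monic: "lead_coeff Q = 1" and irr: "irreducible (of_int_poly Q :: rat poly)"
    and root: "poly (of_int_poly Q) x = 0" and nz: "poly (of_int_poly p) x \<noteq> 0"
    and le: "\<And>z :: complex. poly (of_int_poly Q) z = 0 \<Longrightarrow> z \<noteq> of_real x \<Longrightarrow> cmod (poly (of_int_poly p) z) \<le> B"
    and B: "B \<ge> 1"
  shows "\<bar>poly (of_int_poly p) x\<bar> * B ^ degree Q \<ge> 1"
proof -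
  define Z where "Z = {z :: complex. poly (of_int_poly Q) z = 0}"
  let ?x = "of_real x :: complex"
  have Q0: "(of_int_poly Q :: complex poly) \<noteq> 0" using monic by auto
  have finZ: "finite Z" unfolding Z_def by (rule poly_roots_finite[OF Q0])
  have cardZ: "card Z = degree Q" using card_roots_irreducible[OF irr] unfolding Z_def .
  have ofr: "poly (of_int_poly q) ?x = of_real (poly (of_int_poly q) x)" for q :: "int poly"
  proof -
    have "(of_int_poly q :: complex poly) = map_poly of_real (of_int_poly q)"
      by (simp add: map_poly_map_poly o_def)
    then show ?thesis by simp
  qed
  have xZ: "?x \<in> Z" using root by (simp add: Z_def ofr)
  have "poly (of_int_poly p) z \<noteq> 0" if "z \<in> Z" for z
    using irreducible_nonvanishing[OF irr, of x "of_int_poly p" z] that root nz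
    by (simp add: Z_def poly_of_rat_of_int_poly)
  then have "(\<Prod>z\<in>Z. poly (of_int_poly p) z) \<noteq> 0" using finZ by simp
  moreover have "(\<Prod>z\<in>Z. poly (of_int_poly p) z) \<in> \<int>"
    using conjugate_product_integer[OF monic irr] unfolding Z_def .
  ultimately have "1 \<le> cmod (\<Prod>z\<in>Z. poly (of_int_poly p) z)"
    by (auto elim!: Ints_cases simp flip: of_int_abs)
  also have "\<dots> = (\<Prod>z\<in>Z. cmod (poly (of_int_poly p) z))" by (rule prod_norm[symmetric])
  also have "\<dots> = \<bar>poly (of_int_poly p) x\<bar> * (\<Prod>z\<in>Z-{?x}. cmod (poly (of_int_poly p) z))"
    by (subst prod.remove[OF finZ xZ]) (simp add: ofr)
  also have "(\<Prod>z\<in>Z-{?x}. cmod (poly (of_int_poly p) z)) \<le> (\<Prod>z\<in>Z-{?x}. B)"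
    by (rule prod_mono) (auto simp: Z_def intro: le)
  \<comment> \<open>The root \<open>x\<close> is left out, so the true exponent is
    \<open>degree Q - 1\<close>; \<open>B \<ge> 1\<close> permits the simpler
    \<open>degree Q\<close>.\<close>
  also have "(\<Prod>z\<in>Z-{?x}. B) \<le> B ^ degree Q"
    using xZ finZ B cardZ by (auto intro!: power_increasing)
  finally show ?thesis by (simp add: mult_left_mono)
qed

section \<open>Elements of the field generated by \<beta> as polynomial values\<close>

text \<open>The values of rational polynomials at \<beta> already form a field, since Bezout against
  the minimal polynomial supplies inverses; minimality of the hull then gives the inclusion.\<close>

lemma rat_adjoin_subset:
  fixes \<beta> :: real
  assumes "algebraic_int \<beta>"
  shows "rat_adjoin \<beta> \<subseteq> range (\<lambda>p :: rat poly. poly (map_poly of_rat p) \<beta>)"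
proof -
  obtain Q :: "int poly" where Q: "irreducible (of_int_poly Q :: rat poly)" "poly (of_int_poly Q) \<beta> = 0"
    using algebraic_int_minimal_polynomial[OF assms] by metis
  let ?ev = "\<lambda>p :: rat poly. poly (map_poly of_rat p) \<beta>"
  have "is_subfield (range ?ev)"
    unfolding is_subfield_def
  proof (intro conjI ballI)
    show "0 \<in> range ?ev" "1 \<in> range ?ev"
      by (rule range_eqI[of _ _ 0], simp) (rule range_eqI[of _ _ 1], simp)
  next
    fix x y assume "x \<in> range ?ev" "y \<in> range ?ev"
    then obtain p q where "x = ?ev p" "y = ?ev q" by auto
    then have "x + y = ?ev (p + q)" "x * y = ?ev (p * q)"
      by (simp_all add: hom_distribs poly_of_rat_poly_mult)
    then show "x + y \<in> range ?ev" "x * y \<in> range ?ev" by blast+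
  next
    fix x assume "x \<in> range ?ev"
    then obtain p where p: "x = ?ev p" by auto
    then have "- x = ?ev ([:-1:] * p)"
      unfolding poly_of_rat_poly_mult by (simp add: of_rat_minus)
    then show "- x \<in> range ?ev" by blast
    show "inverse x \<in> range ?ev"
    proof (cases "of_int_poly Q dvd p")
      case True
      then obtain s where "p = of_int_poly Q * s" by (auto simp: dvd_def)
      then have "x = 0" using p Q(2) by (simp add: hom_distribs poly_of_rat_poly_mult poly_of_rat_of_int_poly)
      then show ?thesis by (auto intro: range_eqI[of _ _ 0])
    next
      case False
      then obtain u v where "u * p + v * of_int_poly Q = 1"
        using irreducible_bezout[OF Q(1)] by metis
      then have "?ev (u * p + v * of_int_poly Q) = 1" by simp
      then have "?ev u * x = 1"
        using p Q(2) by (simp add: hom_distribs poly_of_rat_poly_mult poly_of_rat_of_int_poly)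
      then have "inverse x = ?ev u" by (simp add: inverse_unique mult.commute)
      then show ?thesis by blast
    qed
  qed
  moreover have "{\<beta>} \<subseteq> range ?ev"
    by (auto intro!: range_eqI[of _ _ "[:0, 1:]"])
  ultimately show ?thesis unfolding rat_adjoin_def by (rule hull_minimal[rotated])
qed

text \<open>This turns a relation over the field into one whose coefficients are integer polynomials
  in \<beta>, to which the norm argument applies.\<close>

lemma rat_adjoin_common_denominator:
  fixes \<beta> :: real
  assumes "algebraic_int \<beta>" "finite J" "\<And>j. j \<in> J \<Longrightarrow> c j \<in> rat_adjoin \<beta>"
  obtains m :: int and p :: "'j \<Rightarrow> int poly" where "m > 0"
    "\<And>j. j \<in> J \<Longrightarrow> of_int m * c j = poly (of_int_poly (p j)) \<beta>"
proof -
  have "\<exists>n :: int. n > 0 \<and> (\<exists>q :: int poly. of_int n * c j = poly (of_int_poly q) \<beta>)" if j: "j \<in> J" for j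
  proof -
    obtain p :: "rat poly" where p: "c j = poly (map_poly of_rat p) \<beta>"
      using rat_adjoin_subset[OF assms(1)] assms(3)[OF j] by blast
    obtain n q where nq: "rat_to_int_poly p = (n, q)" by force
    note r = rat_to_int_poly[OF nq]
    have "c j = inverse (of_int n) * poly (of_int_poly q) \<beta>"
      unfolding p by (subst r(1)) (simp add: hom_distribs poly_of_rat_poly_mult poly_of_rat_of_int_poly of_rat_inverse)
    with r(2) have "of_int n * c j = poly (of_int_poly q) \<beta>" by simp
    with r(2) show ?thesis by blast
  qed
  then obtain n q where nq: "\<And>j. j \<in> J \<Longrightarrow> n j > 0 \<and> of_int (n j) * c j = poly (of_int_poly (q j)) \<beta>"
    by metis
  show ?thesis
  proof (rule that[of "prod n J" "\<lambda>j. Polynomial.smult (prod n (J - {j})) (q j)"])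
    show "prod n J > 0" using nq by (simp add: prod_pos)
    fix j assume j: "j \<in> J"
    have "of_int (prod n J) * c j = of_int (prod n (J - {j})) * (of_int (n j) * c j)"
      using prod.remove[OF assms(2) j, of n] by (simp add: algebra_simps)
    then show "of_int (prod n J) * c j = poly (of_int_poly (Polynomial.smult (prod n (J - {j})) (q j))) \<beta>"
      using nq[OF j] by (simp add: hom_distribs poly_of_rat_poly_mult)
  qed
qed

subsection \<open>Digit sequences with controlled remainders\<close>

text \<open>\<open>w\<close> stands for the digits and \<open>Y\<close> for the rescaled tails of a
  vanishing series in powers of the inverse of \<beta>.\<close>

locale beta_remainders =
  fixes \<beta> :: real and w Y :: "nat \<Rightarrow> real" and B :: nat
  assumes beta: "\<beta> > 1"
    and rec: "\<And>m. Y (Suc m) = \<beta> * Y m - w (Suc m)"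
    and upper: "\<And>m. \<bar>Y m\<bar> \<le> (real m + 2) ^ B"
    and lower: "\<And>m. Y m \<noteq> 0 \<Longrightarrow> 1 \<le> \<bar>Y m\<bar> * (real m + 2) ^ B"
begin

lemma remainder_shift_le:
  assumes "\<And>i. m < i \<Longrightarrow> i \<le> m + n \<Longrightarrow> w i \<ge> 0"
  shows "Y (m + n) \<le> \<beta> ^ n * Y m"
  using assms
proof (induction n)
  case (Suc n)
  have "Y (m + Suc n) = \<beta> * Y (m + n) - w (m + Suc n)" using rec[of "m + n"] by simp
  also have "\<dots> \<le> \<beta> * Y (m + n)" using Suc.prems[of "m + Suc n"] by simp
  also have "\<dots> \<le> \<beta> * (\<beta> ^ n * Y m)" using Suc beta by (intro mult_left_mono) auto
  finally show ?case by (simp add: mult.assoc)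
qed simp

lemma remainder_shift:
  assumes "\<And>i. m < i \<Longrightarrow> i \<le> m + n \<Longrightarrow> w i = 0"
  shows "Y (m + n) = \<beta> ^ n * Y m"
  using assms by (induction n) (simp_all add: rec)

text \<open>A run of zero digits multiplies the remainder by \<open>\<beta> ^ n\<close>, while it
  has only the room between an inverse power and a power of the argument. So \<open>n\<close> is at
  most logarithmic in \<open>N\<close>.\<close>

lemma vanishing_window_short:
  assumes "\<And>i. m < i \<Longrightarrow> i \<le> m + n \<Longrightarrow> w i = 0" "Y m \<noteq> 0" "m + n \<le> N"
  shows "\<beta> ^ n \<le> (real N + 2) ^ (2 * B)"
proof -
  have "\<beta> ^ n * 1 \<le> \<beta> ^ n * (\<bar>Y m\<bar> * (real m + 2) ^ B)"
    using lower[OF assms(2)] beta by (intro mult_left_mono) auto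
  also have "\<dots> = \<bar>Y (m + n)\<bar> * (real m + 2) ^ B"
    using remainder_shift[OF assms(1)] beta by (simp add: abs_mult)
  also have "\<dots> \<le> (real (m + n) + 2) ^ B * (real m + 2) ^ B"
    by (intro mult_right_mono upper) auto
  also have "\<dots> \<le> (real N + 2) ^ B * (real N + 2) ^ B"
    using assms(3) by (intro mult_mono power_mono) auto
  finally show ?thesis by (simp add: mult_2 power_add)
qed

text \<open>If \<open>Y t\<close> were at most \<open>- c\<close>, nonnegative digits would drive
  the remainder at \<open>e\<close> down to \<open>- c * \<beta> ^ (e - t)\<close>, beyond the bound
  \<open>upper\<close>. So \<open>w t + Y t > 0\<close>, that is \<open>Y (t - 1) > 0\<close>, and
  positivity propagates backwards through
  \<open>\<beta> * Y m = Y (m + 1) + w (m + 1)\<close>.\<close>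

lemma remainder_positive:
  assumes "\<And>i. u < i \<Longrightarrow> i \<le> e \<Longrightarrow> w i \<ge> 0" "u < t" "t \<le> e" "w t \<ge> c"
    "(real e + 2) ^ B < c * \<beta> ^ (e - t)" "u \<le> m" "m < t"
  shows "Y m > 0"
proof -
  have "Y e \<le> \<beta> ^ (e - t) * Y t"
    using remainder_shift_le[of t "e - t"] assms(1,2,3) by simp
  with upper[of e] assms(5) have "\<beta> ^ (e - t) * (c + Y t) > 0" by (simp add: algebra_simps)
  then have "c + Y t > 0" using beta by (simp add: zero_less_mult_iff)
  then have "w t + Y t > 0" using assms(4) by simp
  have "k < t - u \<Longrightarrow> Y (t - 1 - k) > 0" for k
  proof (induction k)
    case 0
    have "Y t = \<beta> * Y (t - 1) - w t" using rec[of "t - 1"] assms(2) by simp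
    with \<open>w t + Y t > 0\<close> have "\<beta> * Y (t - 1) > 0" by simp
    then show ?case using beta by (simp add: zero_less_mult_iff)
  next
    case (Suc k)
    have "Y (t - 1 - k) = \<beta> * Y (t - 1 - Suc k) - w (t - 1 - k)"
      using rec[of "t - 1 - Suc k"] Suc.prems by (simp add: Suc_diff_Suc)
    moreover have "Y (t - 1 - k) > 0" using Suc by simp
    moreover have "w (t - 1 - k) \<ge> 0" using Suc.prems assms(1)[of "t - 1 - k"] assms(2,3) by simp
    ultimately have "\<beta> * Y (t - 1 - Suc k) > 0" by simp
    then show ?case using beta by (simp add: zero_less_mult_iff)
  qed
  from this[of "t - 1 - m"] assms(6,7) show ?thesis by simp
qed

text \<open>Cut the interval into windows of length \<open>L\<close>: a nonzero remainder at the
  start of a window forces a nonzero digit inside it. The extra 1 pays for the incomplete last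
  window.\<close>

lemma many_nonzero_digits:
  assumes L: "(real N + 2) ^ (2 * B) < \<beta> ^ L" and nz: "\<And>m. u \<le> m \<Longrightarrow> m < t \<Longrightarrow> Y m \<noteq> 0" and t: "t \<le> N"
  shows "t - u \<le> L * (1 + card {i \<in> {u<..t}. w i \<noteq> 0})"
proof -
  have L0: "L > 0"
  proof (rule ccontr)
    assume "\<not> L > 0"
    moreover have "(real N + 2) ^ (2 * B) \<ge> 1" by (rule one_le_power) simp
    ultimately show False using L by (metis gr0I leD power_0)
  qed
  have *: "u + q * L \<le> t \<Longrightarrow> q \<le> card {i \<in> {u<..u + q * L}. w i \<noteq> 0}" for q
  proof (induction q)
    case (Suc q)
    have le: "u + q * L + L \<le> t" using Suc.prems by simp
    have "\<exists>i. u + q * L < i \<and> i \<le> u + q * L + L \<and> w i \<noteq> 0"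
    proof (rule ccontr)
      assume "\<not> ?thesis"
      then have "\<beta> ^ L \<le> (real N + 2) ^ (2 * B)"
        using le L0 t by (intro vanishing_window_short[of "u + q * L"] nz) auto
      with L show False by simp
    qed
    then obtain i where i: "u + q * L < i" "i \<le> u + q * L + L" "w i \<noteq> 0" by blast
    have "Suc q \<le> card (insert i {i \<in> {u<..u + q * L}. w i \<noteq> 0})"
      using Suc le i by simp
    also have "\<dots> \<le> card {i \<in> {u<..u + Suc q * L}. w i \<noteq> 0}"
      using i by (intro card_mono) auto
    finally show ?case .
  qed simp
  show ?thesis
  proof (cases "u \<le> t")
    case True
    define q where "q = (t - u) div L"
    have q: "u + q * L \<le> t" using True by (simp add: q_def) (metis add.commute le_diff_conv2 div_times_less_eq_dividend)
    have "t - u < L * (1 + q)"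
      using L0 dividend_less_times_div[of L "t - u"] by (simp add: q_def)
    also have "\<dots> \<le> L * (1 + card {i \<in> {u<..t}. w i \<noteq> 0})"
      using *[OF q] q card_mono[of "{i \<in> {u<..t}. w i \<noteq> 0}" "{i \<in> {u<..u + q * L}. w i \<noteq> 0}"]
      by (intro mult_left_mono add_left_mono) force+
    finally show ?thesis by simp
  qed simp
qed

text \<open>If at least \<open>L\<close> places remain after \<open>t\<close>, the remainders are
  positive on \<open>[u, t)\<close>, so nonzero digits fill this stretch at logarithmic density, and
  \<open>C\<close> compares the stretch with the whole gap.\<close>

lemma gap_length_bound:
  assumes nonneg: "\<And>i. u < i \<Longrightarrow> i < u' \<Longrightarrow> w i \<ge> 0" and u': "u' \<le> N"
    and t: "u < t" "t < u'" "w t \<ge> c" "u' - u \<le> C * (t - u)" "2 * (t - u) \<le> u' - u"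
    and L: "(real N + 2) ^ (2 * B) < \<beta> ^ L" "(real N + 2) ^ B < c * \<beta> ^ L"
  shows "u' - u \<le> (C + 4) * L * (1 + card {i \<in> {u<..<u'}. w i \<noteq> 0})"
proof (cases "u' - 1 - t \<ge> L")
  \<comment> \<open>\<open>t\<close> lies in the first half of the gap, so with fewer than
    \<open>L\<close> places strictly between \<open>t\<close> and \<open>u'\<close> the gap is short
    whatever its digits are.\<close>
  case False
  have "L > 0"
  proof (rule ccontr)
    assume "\<not> L > 0"
    moreover have "(real N + 2) ^ (2 * B) \<ge> 1" by (rule one_le_power) simp
    ultimately show False using L by (metis gr0I leD power_0)
  qed
  have "u' - u \<le> 4 * L" using False t \<open>L > 0\<close> by linarith
  also have "\<dots> \<le> (C + 4) * L * (1 + card {i \<in> {u<..<u'}. w i \<noteq> 0})"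
    by (simp add: algebra_simps)
  finally show ?thesis .
next
  case True
  have c: "c > 0"
  proof -
    have "c * \<beta> ^ L > 0" using L(2) by (rule le_less_trans[rotated]) simp
    then show ?thesis using beta by (simp add: zero_less_mult_iff)
  qed
  have "(real (u' - 1) + 2) ^ B \<le> (real N + 2) ^ B" using u' by (intro power_mono) auto
  also have "\<dots> < c * \<beta> ^ L" by (rule L)
  also have "\<dots> \<le> c * \<beta> ^ (u' - 1 - t)" using c True beta by (intro mult_left_mono power_increasing) auto
  finally have "Y m > 0" if "u \<le> m" "m < t" for m
    using nonneg t that by (intro remainder_positive[of u "u' - 1" t c m]) auto
  then have "t - u \<le> L * (1 + card {i \<in> {u<..t}. w i \<noteq> 0})"
    using t u' by (intro many_nonzero_digits[OF L(1)]) force+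
  also have "\<dots> \<le> L * (1 + card {i \<in> {u<..<u'}. w i \<noteq> 0})"
    using t by (intro mult_left_mono add_left_mono card_mono) auto
  finally have le: "C * (t - u) \<le> C * (L * (1 + card {i \<in> {u<..<u'}. w i \<noteq> 0}))"
    by (intro mult_left_mono) auto
  have "u' - u \<le> C * L * (1 + card {i \<in> {u<..<u'}. w i \<noteq> 0})"
    using order.trans[OF t(4) le] by (simp only: mult.assoc)
  also have "\<dots> \<le> (C + 4) * L * (1 + card {i \<in> {u<..<u'}. w i \<noteq> 0})"
    by (intro mult_right_mono) auto
  finally show ?thesis .
qed

end

section \<open>Counting gaps\<close>

text \<open>The intervals from each point of \<open>S\<close> to its successor partition
  \<open>[0, N)\<close>. Each is charged to the class of its left end, points in both classes being
  charged twice; disjointness ensures that a point of \<open>G\<close> is counted at most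
  once.\<close>

lemma sum_gaps_bound:
  fixes S G :: "nat set"
  assumes S: "S \<subseteq> {..<N}" "0 \<in> S" and S12: "S \<subseteq> S1 \<union> S2" "finite S1" "finite S2"
    and b1: "\<And>u u'. u \<in> S1 \<Longrightarrow> u < u' \<Longrightarrow> u' \<in> insert N S \<Longrightarrow> S \<inter> {u<..<u'} = {} \<Longrightarrow> real (u' - u) \<le> b1"
    and b2: "\<And>u u'. u \<in> S2 \<Longrightarrow> u < u' \<Longrightarrow> u' \<in> insert N S \<Longrightarrow> S \<inter> {u<..<u'} = {} \<Longrightarrow>
               real (u' - u) \<le> b2 * (1 + real (card (G \<inter> {u<..<u'})))"
    and nonneg: "b1 \<ge> 0" "b2 \<ge> 0"
  shows "real N \<le> real (card S1) * b1 + b2 * (real (card S2) + real (card (G \<inter> {..<N})))"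
proof -
  have finS: "finite S" using S(1) finite_subset by blast
  \<comment> \<open>\<open>N\<close> acts as the successor of the last point of
    \<open>S\<close>.\<close>
  define nx where "nx u = Min (insert N {x \<in> S. x > u})" for u
  have nx: "u < nx u" "nx u \<in> insert N S" "S \<inter> {u<..<nx u} = {}" "nx u \<le> N" if "u \<in> S" for u
  proof -
    let ?X = "insert N {x \<in> S. x > u}"
    have f: "finite ?X" "?X \<noteq> {}" using finS by auto
    have m: "nx u \<in> ?X" unfolding nx_def by (rule Min_in[OF f])
    then show "u < nx u" "nx u \<in> insert N S" using that S(1) by auto
    show "nx u \<le> N" unfolding nx_def using f by (intro Min_le) auto
    have "nx u \<le> x" if "x \<in> S" "x > u" for x unfolding nx_def using f that by (intro Min_le) auto
    then show "S \<inter> {u<..<nx u} = {}" by fastforce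
  qed
  have disj: "{u..<nx u} \<inter> {v..<nx v} = {}" if "u \<in> S" "v \<in> S" "u < v" for u v
  proof -
    have "nx u \<le> v" using nx(3)[OF that(1)] that by (metis Int_iff emptyE greaterThanLessThan_iff not_less)
    then show ?thesis by auto
  qed
  have disj': "{u..<nx u} \<inter> {v..<nx v} = {}" if "u \<in> S" "v \<in> S" "u \<noteq> v" for u v
    using disj[of u v] disj[of v u] that by (cases u v rule: linorder_cases) auto
  have cover: "{..<N} = (\<Union>u\<in>S. {u..<nx u})"
  proof (intro equalityI subsetI)
    fix x assume x: "x \<in> {..<N}"
    define u where "u = Max {y \<in> S. y \<le> x}"
    have f: "finite {y \<in> S. y \<le> x}" "{y \<in> S. y \<le> x} \<noteq> {}" using finS S(2) by auto
    have u: "u \<in> S" "u \<le> x" using Max_in[OF f] unfolding u_def by auto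
    have "x < nx u"
    proof (rule ccontr)
      assume "\<not> x < nx u"
      then have "nx u \<le> x" by simp
      moreover from this have "nx u \<in> S" using nx(2)[OF u(1)] x by auto
      ultimately have "nx u \<le> u" unfolding u_def using f by (intro Max_ge) auto
      with nx(1)[OF u(1)] show False by simp
    qed
    with u show "x \<in> (\<Union>u\<in>S. {u..<nx u})" by auto
  next
    fix x assume "x \<in> (\<Union>u\<in>S. {u..<nx u})"
    then obtain u where "u \<in> S" "x < nx u" by auto
    with nx(4)[of u] show "x \<in> {..<N}" by auto
  qed
  have "card {..<N} = (\<Sum>u\<in>S. card {u..<nx u})"
    unfolding cover using finS disj' by (intro card_UN_disjoint) auto
  then have "real N = (\<Sum>u\<in>S. real (nx u - u))" by simp
  also have "\<dots> \<le> (\<Sum>u\<in>S \<inter> S1. real (nx u - u)) + (\<Sum>u\<in>S \<inter> S2. real (nx u - u))"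
  proof -
    have "(\<Sum>u\<in>S. real (nx u - u)) = (\<Sum>u\<in>(S \<inter> S1) \<union> (S \<inter> S2). real (nx u - u))"
      using S12(1) by (intro sum.cong) auto
    also have "\<dots> \<le> (\<Sum>u\<in>S \<inter> S1. real (nx u - u)) + (\<Sum>u\<in>S \<inter> S2. real (nx u - u))"
      using finS by (subst sum.union_inter[symmetric]) (auto intro!: sum_nonneg)
    finally show ?thesis .
  qed
  also have "(\<Sum>u\<in>S \<inter> S1. real (nx u - u)) \<le> (\<Sum>u\<in>S \<inter> S1. b1)"
    using nx by (intro sum_mono b1) auto
  also have "\<dots> \<le> real (card S1) * b1"
    using nonneg S12 by (auto intro!: mult_right_mono card_mono)
  also have "(\<Sum>u\<in>S \<inter> S2. real (nx u - u)) \<le> (\<Sum>u\<in>S \<inter> S2. b2 * (1 + real (card (G \<inter> {u<..<nx u}))))"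
    using nx by (intro sum_mono b2) auto
  also have "\<dots> = b2 * (real (card (S \<inter> S2)) + real (\<Sum>u\<in>S \<inter> S2. card (G \<inter> {u<..<nx u})))"
    by (simp add: sum_distrib_left[symmetric] sum.distrib)
  also have "\<dots> \<le> b2 * (real (card S2) + real (card (G \<inter> {..<N})))"
  proof (intro mult_left_mono add_mono)
    have "(\<Sum>u\<in>S \<inter> S2. card (G \<inter> {u<..<nx u})) = card (\<Union>u\<in>S \<inter> S2. G \<inter> {u<..<nx u})"
      using finS disj' by (intro card_UN_disjoint[symmetric]) (auto, fastforce)
    also have "\<dots> \<le> card (G \<inter> {..<N})"
      using nx(4) by (intro card_mono) (auto, fastforce)
    finally show "real (\<Sum>u\<in>S \<inter> S2. card (G \<inter> {u<..<nx u})) \<le> real (card (G \<inter> {..<N}))" by (simp only: of_nat_le_iff)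
    show "real (card (S \<inter> S2)) \<le> real (card S2)" using S12 by (auto intro!: card_mono)
  qed (use nonneg in auto)
  finally show ?thesis by simp
qed

text \<open>\<open>F\<close> is the scale of the gaps allowed after points of \<open>U1\<close>,
  which number at most about \<open>N / F N\<close>. Gaps after points of \<open>U2\<close> are
  charged, with logarithmic weight, to the few points of \<open>U2\<close> and \<open>G\<close>. The
  constants are arranged so that the two contributions are at most 3/8 and 1/8 of
  \<open>N\<close>.\<close>

lemma (in beta_remainders) sparse_digits_contradiction:
  fixes U1 U2 G :: "nat set" and F :: "nat \<Rightarrow> real" and c d C :: real and C4 :: nat
  assumes c: "c > 0" and off: "\<And>m. m \<notin> U1 \<Longrightarrow> m \<notin> U2 \<Longrightarrow> m \<notin> G \<Longrightarrow> w m = 0"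
    and on: "\<And>m. m \<notin> U1 \<Longrightarrow> m \<notin> U2 \<Longrightarrow> m \<in> G \<Longrightarrow> w m \<ge> c"
    and gap: "\<And>\<epsilon>. \<epsilon> > 0 \<Longrightarrow> \<forall>\<^sub>F N in sequentially. \<exists>v\<in>U2. v < N \<and> real N - real v \<le> \<epsilon> * F N"
    and F: "filterlim F at_top sequentially"
    and dense: "\<forall>\<^sub>F n in sequentially. \<forall>u\<in>U2. \<exists>t\<in>U2 \<union> G. u < t \<and> n \<le> C4 * (t - u) \<and> 2 * (t - u) \<le> n"
    and U1: "\<forall>\<^sub>F N in sequentially. (real (card (U1 \<inter> {..<N})) + 1) * F N \<le> C * real N"
    and d: "d > 0"
    and U2: "\<forall>\<^sub>F N in sequentially. real (card (U2 \<inter> {..<N})) + real (card (G \<inter> {..<N})) \<le> C * real N powr (1 - d)"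
    and C: "C > 0"
  shows False
proof -
  obtain n0 where n0: "\<And>n u. n \<ge> n0 \<Longrightarrow> u \<in> U2 \<Longrightarrow> \<exists>t\<in>U2 \<union> G. u < t \<and> n \<le> C4 * (t - u) \<and> 2 * (t - u) \<le> n"
    using dense unfolding eventually_sequentially by blast
  \<comment> \<open>With a further \<open>1 / (8 * C)\<close> spent on absorbing \<open>N0\<close>,
    the gaps after \<open>U1\<close> get the share 3/8 of \<open>N\<close>.\<close>
  define \<epsilon> where "\<epsilon> = 1 / (4 * C)"
  have \<epsilon>: "\<epsilon> > 0" using C by (simp add: \<epsilon>_def)
  obtain N0 where N0: "\<And>N. N \<ge> N0 \<Longrightarrow> \<exists>v\<in>U2. v < N \<and> real N - real v \<le> \<epsilon> * F N"
    using gap[OF \<epsilon>] unfolding eventually_sequentially by blast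
  \<comment> \<open>Windows need the exponent \<open>2 * B\<close>; the spare factor
    \<open>N + 2\<close> is there to outgrow \<open>1 / c\<close>.\<close>
  define K where "K = (2 * B + 1) / ln \<beta>"
  have lnb: "ln \<beta> > 0" using beta by simp
  define L where "L N = nat \<lceil>K * ln (real N + 2)\<rceil> + 1" for N :: nat
  have L_pow: "(real N + 2) ^ (2 * B + 1) < \<beta> ^ L N" for N
  proof -
    have "(real N + 2) ^ (2 * B + 1) = exp (real (2 * B + 1) * ln (real N + 2))"
      by (subst exp_of_nat_mult) simp
    also have "\<dots> = exp ((K * ln (real N + 2)) * ln \<beta>)" using lnb by (simp add: K_def)
    also have "\<dots> < exp (real (L N) * ln \<beta>)"
      using lnb by (simp add: L_def) linarith
    also have "\<dots> = \<beta> ^ L N" using beta by (subst exp_of_nat_mult) simp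
    finally show ?thesis .
  qed
  \<comment> \<open>\<open>n0\<close> pays for gaps too short for the density assumption.
    \<open>M\<close> is logarithmic, hence negligible against \<open>N powr d\<close>.\<close>
  define M where "M N = real ((C4 + 4) * L N + n0)" for N :: nat
  have M_small: "\<forall>\<^sub>F N in sequentially. M N * (2 * (C * real N powr (1 - d))) \<le> real N / 8"
  proof -
    have "L N \<le> K * ln (real N + 2) + 2" for N
    proof -
      have "K * ln (real N + 2) \<ge> 0" using lnb by (simp add: K_def)
      then show ?thesis unfolding L_def by linarith
    qed
    then have *: "M N \<le> (C4 + 4) * (K * ln (real N + 2) + 2) + n0" for N
      unfolding M_def of_nat_add of_nat_mult by (intro add_mono mult_left_mono order.refl) auto
    have "\<forall>\<^sub>F N in sequentially. ((real C4 + 4) * (K * ln (real N + 2) + 2) + real n0) * (2 * (C * real N powr (1 - d))) \<le> real N / 8"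
      using d C lnb by (auto simp: K_def) real_asymp
    then show ?thesis
    proof eventually_elim
      case (elim N)
      have "M N * (2 * (C * real N powr (1 - d))) \<le>
        ((real C4 + 4) * (K * ln (real N + 2) + 2) + real n0) * (2 * (C * real N powr (1 - d)))"
        using *[of N] C by (intro mult_right_mono) auto
      with elim show ?case by simp
    qed
  qed
  have c_large: "\<forall>\<^sub>F N in sequentially. 1 < c * (real N + 2)"
    using c by real_asymp
  have F_large: "\<forall>\<^sub>F N in sequentially. F N \<ge> 8 * C * (real N0 + 1)"
    using F by (simp add: filterlim_at_top)
  obtain N1 where N1: "\<And>N. N \<ge> N1 \<Longrightarrow>
      (real (card (U1 \<inter> {..<N})) + 1) * F N \<le> C * real N \<and>
      real (card (U2 \<inter> {..<N})) + real (card (G \<inter> {..<N})) \<le> C * real N powr (1 - d) \<and>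
      M N * (2 * (C * real N powr (1 - d))) \<le> real N / 8 \<and> 1 < c * (real N + 2) \<and> F N \<ge> 8 * C * (real N0 + 1)"
    using eventually_conj[OF U1 eventually_conj[OF U2 eventually_conj[OF M_small eventually_conj[OF c_large F_large]]]]
    unfolding eventually_sequentially by blast
  text \<open>A record of \<open>F\<close>: only there does the bound on the gaps at smaller arguments carry over.\<close>
  obtain N where N: "N \<ge> N1" "N \<ge> 1" "\<And>m. m \<le> N \<Longrightarrow> F m \<le> F N"
  proof -
    \<comment> \<open>Once \<open>F n > b\<close>, the maximum of \<open>F\<close> up to
      \<open>n\<close> is attained beyond \<open>N1 + 1\<close>, and its place is the desired
      record.\<close>
    define b where "b = Max (F ` {..N1 + 1})"
    obtain n where n: "F n > b" "n \<ge> N1 + 1"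
    proof -
      have "\<forall>\<^sub>F n in sequentially. F n > b \<and> n \<ge> N1 + 1"
        using F by (auto simp: filterlim_at_top_dense eventually_ge_at_top intro!: eventually_conj)
      then show ?thesis using that by (metis (no_types, lifting) eventually_sequentially order.refl)
    qed
    have "Max (F ` {..n}) \<in> F ` {..n}" by (intro Max_in) auto
    then obtain m where m: "m \<le> n" "F m = Max (F ` {..n})" by (metis imageE atMost_iff)
    have mx: "F k \<le> F m" if "k \<le> n" for k using that unfolding m(2) by (intro Max_ge) auto
    have "m > N1 + 1"
    proof (rule ccontr)
      assume "\<not> m > N1 + 1"
      then have "F m \<le> b" unfolding b_def by (intro Max_ge) auto
      with mx[of n] n show False by simp
    qed
    then show ?thesis using mx m(1) by (intro that[of m]) auto
  qed
  note N1' = N1[OF N(1)]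
  have FN: "F N \<ge> 8 * C * (real N0 + 1)" using N1' by blast
  have FN0: "F N > 0" by (rule less_le_trans[OF _ FN]) (use C in simp)
  \<comment> \<open>The point 0 is added so that the gaps cover all of \<open>[0, N)\<close>; it is
    counted along with \<open>U1\<close>, whence the 1 added to its cardinality.\<close>
  define S where "S = insert 0 ((U1 \<union> U2) \<inter> {..<N})"
  have LN: "(real N + 2) ^ (2 * B) < \<beta> ^ L N" "(real N + 2) ^ B < c * \<beta> ^ L N"
  proof -
    have p1: "(real N + 2) ^ (2 * B) \<le> (real N + 2) ^ (2 * B + 1)" by (intro power_increasing) auto
    from le_less_trans[OF p1 L_pow[of N]] show "(real N + 2) ^ (2 * B) < \<beta> ^ L N" .
    have "(real N + 2) ^ B \<le> (real N + 2) ^ (2 * B)" by (intro power_increasing) auto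
    also have "\<dots> < c * (real N + 2) * (real N + 2) ^ (2 * B)"
      using N1' mult_strict_right_mono[of 1 "c * (real N + 2)" "(real N + 2) ^ (2 * B)"] by simp
    also have "\<dots> = c * (real N + 2) ^ (2 * B + 1)" by simp
    also have "\<dots> < c * \<beta> ^ L N" using L_pow[of N] c by (intro mult_strict_left_mono)
    finally show "(real N + 2) ^ B < c * \<beta> ^ L N" .
  qed
  have "real N \<le> real (card (insert 0 (U1 \<inter> {..<N}))) * (\<epsilon> * F N + real N0) +
      M N * (real (card (U2 \<inter> {..<N})) + real (card (G \<inter> {..<N})))"
  proof (rule sum_gaps_bound)
    show "S \<subseteq> {..<N}" "0 \<in> S" "S \<subseteq> insert 0 (U1 \<inter> {..<N}) \<union> (U2 \<inter> {..<N})" using N(2) by (auto simp: S_def)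
    show "\<epsilon> * F N + real N0 \<ge> 0" "M N \<ge> 0" using \<epsilon> FN0 by (auto simp: M_def)
  next
    fix u u' assume u: "u < u'" "u' \<in> insert N S" "S \<inter> {u<..<u'} = {}"
    have u'N: "u' \<le> N" using u(2) N(2) by (auto simp: S_def)
    show "real (u' - u) \<le> \<epsilon> * F N + real N0"
    proof (cases "u' \<ge> N0")
      case True
      then obtain v where v: "v \<in> U2" "v < u'" "real u' - real v \<le> \<epsilon> * F u'" using N0 by blast
      \<comment> \<open>No point of \<open>S\<close> lies strictly inside the gap, so
        \<open>v\<close> is at most \<open>u\<close> and its distance to \<open>u'\<close> bounds
        the gap.\<close>
      have "v \<in> S" using v u'N by (auto simp: S_def)
      with u v have "v \<le> u" by (metis Int_iff emptyE greaterThanLessThan_iff not_less)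
      then have "real (u' - u) \<le> \<epsilon> * F u'" using v u(1) by simp
      also have "\<dots> \<le> \<epsilon> * F N" using N(3)[OF u'N] \<epsilon> by simp
      finally show ?thesis by simp
    next
      case False
      moreover have "\<epsilon> * F N \<ge> 0" using \<epsilon> FN0 by simp
      ultimately show ?thesis by simp
    qed
  next
    fix u u' assume u2: "u \<in> U2 \<inter> {..<N}" and u: "u < u'" "u' \<in> insert N S" "S \<inter> {u<..<u'} = {}"
    have u'N: "u' \<le> N" using u(2) N(2) by (auto simp: S_def)
    have offU: "i \<notin> U1" "i \<notin> U2" if "u < i" "i < u'" for i
      using u(3) that u'N by (auto simp: S_def)
    have pos: "w i \<ge> 0" if "u < i" "i < u'" for i
      using off[of i] on[of i] offU[OF that] c by (cases "i \<in> G") auto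
    show "real (u' - u) \<le> M N * (1 + real (card (G \<inter> {u<..<u'})))"
    proof (cases "u' - u \<ge> n0")
      case False
      then have "u' - u \<le> (C4 + 4) * L N + n0" by simp
      then have "real (u' - u) \<le> M N * 1" by (simp only: M_def of_nat_le_iff mult_1_right)
      also have "\<dots> \<le> M N * (1 + real (card (G \<inter> {u<..<u'})))"
        by (intro mult_left_mono) (auto simp: M_def)
      finally show ?thesis .
    next
      case True
      then obtain t where t: "t \<in> U2 \<union> G" "u < t" "u' - u \<le> C4 * (t - u)" "2 * (t - u) \<le> u' - u"
        using n0 u2 by blast
      \<comment> \<open>As \<open>t\<close> falls strictly inside the gap, it is outside
        \<open>U1\<close> and \<open>U2\<close>, and the density assumption leaves only
        \<open>G\<close>.\<close>
      have tu: "t < u'" using t u(1) by linarith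
      have "w t \<ge> c" using on[of t] offU[OF t(2) tu] t(1) by blast
      then have "u' - u \<le> (C4 + 4) * L N * (1 + card {i \<in> {u<..<u'}. w i \<noteq> 0})"
        using pos u'N t tu LN by (intro gap_length_bound) auto
      also have "\<dots> \<le> ((C4 + 4) * L N + n0) * (1 + card (G \<inter> {u<..<u'}))"
        using offU off by (intro mult_mono add_left_mono card_mono) auto
      finally have "real (u' - u) \<le> real (((C4 + 4) * L N + n0) * (1 + card (G \<inter> {u<..<u'})))"
        by (rule of_nat_mono)
      then show ?thesis by (simp only: M_def of_nat_mult of_nat_add of_nat_1)
    qed
  qed auto
  also have "real (card (insert 0 (U1 \<inter> {..<N}))) * (\<epsilon> * F N + real N0) \<le> (real (card (U1 \<inter> {..<N})) + 1) * (\<epsilon> * F N + real N0)"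
  proof (intro mult_right_mono)
    have "card (insert 0 (U1 \<inter> {..<N})) \<le> card (U1 \<inter> {..<N}) + 1" by (simp add: card_insert_if)
    then show "real (card (insert 0 (U1 \<inter> {..<N}))) \<le> real (card (U1 \<inter> {..<N})) + 1" by linarith
  qed (use \<epsilon> FN0 in auto)
  also have "\<dots> \<le> (real (card (U1 \<inter> {..<N})) + 1) * ((\<epsilon> + 1 / (8 * C)) * F N)"
  proof (intro mult_left_mono)
    have "8 * C * real N0 \<le> F N" using FN C by (simp add: algebra_simps)
    then show "\<epsilon> * F N + real N0 \<le> (\<epsilon> + 1 / (8 * C)) * F N" using C by (simp add: field_simps)
  qed auto
  also have "\<dots> = (3 / (8 * C)) * ((real (card (U1 \<inter> {..<N})) + 1) * F N)"
    using C by (simp add: \<epsilon>_def field_simps)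
  also have "\<dots> \<le> (3 / (8 * C)) * (C * real N)"
    using N1' C by (intro mult_left_mono) auto
  also have "\<dots> = 3 / 8 * real N" using C by simp
  also have "M N * (real (card (U2 \<inter> {..<N})) + real (card (G \<inter> {..<N}))) \<le> M N * (2 * (C * real N powr (1 - d)))"
    using N1' C by (intro mult_left_mono) (auto simp: M_def intro: order.trans)
  also have "\<dots> \<le> real N / 8" using N1' by blast
  finally have "real N \<le> 3 / 8 * real N + real N / 8" by simp
  with N(2) show False by simp
qed

subsection \<open>Power series with nonnegative coefficients\<close>

text \<open>Nonnegative coefficients exclude cancellation, so one pair of nonzero coefficients
  suffices.\<close>

lemma fps_supp_mult:
  assumes "\<And>n. fps_nth a n \<ge> 0" "\<And>n. fps_nth b n \<ge> 0"
  shows "fps_supp (a * b) = fps_supp a + fps_supp b"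
proof (intro equalityI subsetI)
  fix n assume "n \<in> fps_supp (a * b)"
  then have "(\<Sum>i=0..n. fps_nth a i * fps_nth b (n - i)) \<noteq> 0" by (simp add: fps_supp_def fps_mult_nth)
  then obtain i where i: "i \<in> {0..n}" "fps_nth a i * fps_nth b (n - i) \<noteq> 0" by (metis (no_types, lifting) sum.neutral)
  then have "i \<in> fps_supp a" "n - i \<in> fps_supp b" "n = i + (n - i)" by (auto simp: fps_supp_def)
  then show "n \<in> fps_supp a + fps_supp b" by (metis set_plus_intro)
next
  fix n assume "n \<in> fps_supp a + fps_supp b"
  then obtain i j where ij: "n = i + j" "fps_nth a i \<noteq> 0" "fps_nth b j \<noteq> 0" by (auto simp: fps_supp_def elim!: set_plus_elim)
  have "0 < fps_nth a i * fps_nth b (n - i)" using ij assms[of i] assms(2)[of j] by (simp add: less_le)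
  also have "\<dots> \<le> (\<Sum>i=0..n. fps_nth a i * fps_nth b (n - i))"
    using ij assms by (intro member_le_sum) auto
  finally show "n \<in> fps_supp (a * b)" by (simp add: fps_supp_def fps_mult_nth)
qed

lemma fps_supp_1 [simp]: "fps_supp 1 = {0}"
  by (auto simp: fps_supp_def)

lemma fps_nonneg_mult:
  assumes "\<And>n. fps_nth a n \<ge> 0" "\<And>n. fps_nth b n \<ge> (0 :: real)"
  shows "fps_nth (a * b) n \<ge> 0"
  using assms by (auto simp: fps_mult_nth intro!: sum_nonneg)

lemma fps_nonneg_power:
  assumes "\<And>n. fps_nth a n \<ge> (0 :: real)"
  shows "fps_nth (a ^ k) n \<ge> 0"
  by (induction k arbitrary: n) (auto intro: fps_nonneg_mult assms)

lemma fps_nonneg_prod: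
  assumes "\<And>i n. i \<in> I \<Longrightarrow> fps_nth (a i) n \<ge> (0 :: real)"
  shows "fps_nth (\<Prod>i\<in>I. a i) n \<ge> 0"
  using assms by (induction I arbitrary: n rule: infinite_finite_induct) (auto intro!: fps_nonneg_mult)

lemma fps_supp_power:
  assumes "\<And>n. fps_nth a n \<ge> 0"
  shows "fps_supp (a ^ k) = sumset_power k (fps_supp a)"
proof (induction k)
  case (Suc k)
  have "fps_supp (a ^ Suc k) = fps_supp (a ^ k) + fps_supp a"
    unfolding power_Suc2 using assms by (intro fps_supp_mult fps_nonneg_power)
  with Suc show ?case by (simp add: sumset_power_def)
qed (simp add: sumset_power_def set_zero)

lemma fps_supp_prod:
  assumes "finite I" "\<And>i n. i \<in> I \<Longrightarrow> fps_nth (a i) n \<ge> 0"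
  shows "fps_supp (\<Prod>i\<in>I. a i) = (\<Sum>i\<in>I. fps_supp (a i))"
  using assms
proof (induction I)
  case (insert i I)
  then show ?case by (simp add: fps_supp_mult fps_nonneg_prod)
qed (simp add: set_zero)

lemma card_plus_le:
  fixes A B :: "nat set"
  shows "card ((A + B) \<inter> {..<N}) \<le> card (A \<inter> {..<N}) * card (B \<inter> {..<N})"
proof -
  have "(A + B) \<inter> {..<N} \<subseteq> (\<lambda>(x, y). x + y) ` ((A \<inter> {..<N}) \<times> (B \<inter> {..<N}))"
    by (force elim!: set_plus_elim)
  then have "card ((A + B) \<inter> {..<N}) \<le> card ((A \<inter> {..<N}) \<times> (B \<inter> {..<N}))"
    by (intro surj_card_le) auto
  then show ?thesis by (simp add: card_cartesian_product)
qed

lemma card_fps_supp_power_le: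
  assumes "\<And>n. fps_nth a n \<ge> 0"
  shows "card (fps_supp (a ^ k) \<inter> {..<N}) \<le> card (fps_supp a \<inter> {..<N}) ^ k"
proof (induction k)
  case 0
  show ?case using card_mono[of "{0}" "{0} \<inter> {..<N}"] by simp
next
  case (Suc k)
  have "card (fps_supp (a ^ Suc k) \<inter> {..<N}) \<le> card (fps_supp a \<inter> {..<N}) * card (fps_supp (a ^ k) \<inter> {..<N})"
    using assms card_plus_le by (simp add: fps_supp_mult fps_nonneg_power)
  also have "\<dots> \<le> card (fps_supp a \<inter> {..<N}) * card (fps_supp a \<inter> {..<N}) ^ k"
    using Suc by (rule mult_left_mono) simp
  finally show ?case by simp
qed

lemma card_fps_supp_prod_power_le:
  assumes "finite I" "\<And>i n. i \<in> I \<Longrightarrow> fps_nth (a i) n \<ge> 0"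
  shows "card (fps_supp (\<Prod>i\<in>I. a i ^ k i) \<inter> {..<N}) \<le> (\<Prod>i\<in>I. card (fps_supp (a i) \<inter> {..<N}) ^ k i)"
  using assms
proof (induction I)
  case empty
  show ?case using card_mono[of "{0}" "{0} \<inter> {..<N}"] by simp
next
  case (insert i I)
  have "card (fps_supp (\<Prod>i\<in>insert i I. a i ^ k i) \<inter> {..<N})
      \<le> card (fps_supp (a i ^ k i) \<inter> {..<N}) * card (fps_supp (\<Prod>i\<in>I. a i ^ k i) \<inter> {..<N})"
    using insert card_plus_le by (simp add: fps_supp_mult fps_nonneg_power fps_nonneg_prod)
  also have "\<dots> \<le> card (fps_supp (a i) \<inter> {..<N}) ^ k i * (\<Prod>i\<in>I. card (fps_supp (a i) \<inter> {..<N}) ^ k i)"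
    using insert by (intro mult_mono card_fps_supp_power_le) auto
  finally show ?case using insert by simp
qed

section \<open>Power series with polynomially bounded coefficients\<close>

text \<open>The base is at least 2 even at \<open>n = 0\<close>, so raising the exponent absorbs any
  constant factor.\<close>

definition fps_poly_growth :: "real fps \<Rightarrow> bool" where
  "fps_poly_growth a \<longleftrightarrow> (\<exists>b. \<forall>n. \<bar>fps_nth a n\<bar> \<le> (real n + 2) ^ b)"

lemma const_le_two_power: "\<exists>b. (C :: real) \<le> 2 ^ b"
  using real_arch_pow[of 2 C] by (auto intro: less_imp_le)

lemma fps_poly_growth_1: "fps_poly_growth 1"
  unfolding fps_poly_growth_def by (rule exI[of _ 0]) auto

lemma fps_poly_growth_bounded:
  assumes "\<And>n. \<bar>fps_nth a n\<bar> \<le> C"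
  shows "fps_poly_growth a"
proof -
  obtain b where "C \<le> 2 ^ b" using const_le_two_power by blast
  moreover have "(2 :: real) ^ b \<le> (real n + 2) ^ b" for n by (intro power_mono) auto
  ultimately show ?thesis using assms unfolding fps_poly_growth_def by (meson order.trans)
qed

lemma fps_poly_growth_mult:
  assumes "fps_poly_growth a" "fps_poly_growth b"
  shows "fps_poly_growth (a * b)"
proof -
  obtain k l where k: "\<And>n. \<bar>fps_nth a n\<bar> \<le> (real n + 2) ^ k" and l: "\<And>n. \<bar>fps_nth b n\<bar> \<le> (real n + 2) ^ l"
    using assms unfolding fps_poly_growth_def by blast
  have "\<bar>fps_nth (a * b) n\<bar> \<le> (real n + 2) ^ (1 + k + l)" for n
  proof -
    have "\<bar>fps_nth (a * b) n\<bar> \<le> (\<Sum>i=0..n. \<bar>fps_nth a i * fps_nth b (n - i)\<bar>)"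
      unfolding fps_mult_nth by (rule sum_abs)
    also have "\<dots> \<le> (\<Sum>i=0..n. (real n + 2) ^ k * (real n + 2) ^ l)"
    proof (rule sum_mono)
      fix i assume i: "i \<in> {0..n}"
      have "\<bar>fps_nth a i\<bar> \<le> (real n + 2) ^ k"
        using i by (intro order.trans[OF k] power_mono) auto
      moreover have "\<bar>fps_nth b (n - i)\<bar> \<le> (real n + 2) ^ l"
        using i by (intro order.trans[OF l] power_mono) auto
      ultimately show "\<bar>fps_nth a i * fps_nth b (n - i)\<bar> \<le> (real n + 2) ^ k * (real n + 2) ^ l"
        unfolding abs_mult by (intro mult_mono) auto
    qed
    also have "\<dots> = (real n + 1) * (real n + 2) ^ (k + l)" by (simp add: power_add)
    also have "\<dots> \<le> (real n + 2) * (real n + 2) ^ (k + l)" by (intro mult_right_mono) auto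
    finally show ?thesis by simp
  qed
  then show ?thesis unfolding fps_poly_growth_def by blast
qed

lemma fps_poly_growth_power: "fps_poly_growth a \<Longrightarrow> fps_poly_growth (a ^ k)"
  by (induction k) (auto intro: fps_poly_growth_mult fps_poly_growth_1)

lemma fps_poly_growth_prod: "(\<And>i. i \<in> I \<Longrightarrow> fps_poly_growth (a i)) \<Longrightarrow> fps_poly_growth (\<Prod>i\<in>I. a i)"
  by (induction I rule: infinite_finite_induct) (auto intro: fps_poly_growth_mult fps_poly_growth_1)

lemma summable_power_growth:
  fixes x :: real
  assumes "0 \<le> x" "x < 1"
  shows "summable (\<lambda>n. (real n + 2) ^ b * x ^ n)"
proof (cases "x = 0")
  case False
  have "(\<lambda>n. (real n + 2) ^ b * x ^ n) \<in> O(\<lambda>n. sqrt x ^ n)"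
  proof -
    have x: "0 < x" "x < 1" using False assms by auto
    have "(\<lambda>n. (real n + 2) ^ b * x ^ n) \<in> O(\<lambda>n. (x powr (1/2)) ^ n)"
      using x by real_asymp
    then show ?thesis using x by (simp add: powr_half_sqrt)
  qed
  moreover have "summable (\<lambda>n. norm (sqrt x ^ n))" using assms by (simp add: norm_power summable_geometric)
  ultimately show ?thesis by (rule summable_comparison_test_bigo[rotated])
qed (rule summable_finite[of "{0}"], auto)

lemma fps_poly_growth_conv_radius:
  assumes "fps_poly_growth a"
  shows "fps_conv_radius a \<ge> 1"
  unfolding fps_conv_radius_def
proof (rule conv_radius_geI_ex')
  fix r :: real assume r: "0 < r" "ereal r < 1"
  obtain b where b: "\<And>n. \<bar>fps_nth a n\<bar> \<le> (real n + 2) ^ b"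
    using assms unfolding fps_poly_growth_def by blast
  have "summable (\<lambda>n. (real n + 2) ^ b * r ^ n)" using r by (intro summable_power_growth) auto
  then show "summable (\<lambda>n. fps_nth a n * of_real r ^ n)"
    by (rule summable_comparison_test'[where N = 0])
      (use r b in \<open>auto simp: abs_mult power_abs intro!: mult_right_mono\<close>)
qed

lemma eval_fps_prod_power:
  assumes "\<And>i. i \<in> I \<Longrightarrow> fps_poly_growth (a i)" "\<bar>x\<bar> < 1"
  shows "eval_fps (\<Prod>i\<in>I. a i ^ k i) x = (\<Prod>i\<in>I. eval_fps (a i) x ^ k i)"
  using assms(1)
proof (induction I rule: infinite_finite_induct)
  case (insert i I)
  have conv: "ereal \<bar>x\<bar> < fps_conv_radius b" if "fps_poly_growth b" for b
    using fps_poly_growth_conv_radius[OF that] assms(2) by (metis ereal_less(3) less_le_trans real_norm_def)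
  have "eval_fps (a i ^ k i * (\<Prod>i\<in>I. a i ^ k i)) x = eval_fps (a i) x ^ k i * (\<Prod>i\<in>I. eval_fps (a i) x ^ k i)"
    using insert by (subst eval_fps_mult) (auto intro!: conv fps_poly_growth_power fps_poly_growth_prod simp: eval_fps_power conv)
  with insert show ?case by simp
qed auto

lemma sums_fps_poly_growth:
  assumes "fps_poly_growth a" "\<bar>x\<bar> < 1"
  shows "(\<lambda>n. fps_nth a n * x ^ n) sums eval_fps a x"
proof -
  have "ereal (norm x) < fps_conv_radius a"
    using fps_poly_growth_conv_radius[OF assms(1)] assms(2) by (metis ereal_less(3) less_le_trans real_norm_def)
  then show ?thesis by (rule sums_eval_fps)
qed

lemma fps_Ints_mult:
  assumes "\<And>n. fps_nth a n \<in> \<int>" "\<And>n. fps_nth b n \<in> (\<int> :: real set)"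
  shows "fps_nth (a * b) n \<in> \<int>"
  using assms by (auto simp: fps_mult_nth intro!: Ints_sum Ints_mult)

lemma fps_Ints_power: "(\<And>n. fps_nth a n \<in> (\<int> :: real set)) \<Longrightarrow> fps_nth (a ^ k) n \<in> \<int>"
  by (induction k arbitrary: n) (auto intro!: fps_Ints_mult)

lemma fps_Ints_prod: "(\<And>i n. i \<in> I \<Longrightarrow> fps_nth (a i) n \<in> (\<int> :: real set)) \<Longrightarrow> fps_nth (\<Prod>i\<in>I. a i) n \<in> \<int>"
  by (induction I arbitrary: n rule: infinite_finite_induct) (auto intro!: fps_Ints_mult)

lemma infinite_fps_supp:
  assumes "a \<notin> range fps_of_poly"
  shows "infinite (fps_supp a)"
proof
  assume "finite (fps_supp a)"
  then obtain n where n: "\<And>m. m \<in> fps_supp a \<Longrightarrow> m < n" by (metis finite_nat_bounded lessThan_iff subsetD)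
  have "a = fps_of_poly (\<Sum>i<n. Polynomial.monom (fps_nth a i) i)"
  proof (rule fps_ext)
    fix m show "fps_nth a m = fps_nth (fps_of_poly (\<Sum>i<n. Polynomial.monom (fps_nth a i) i)) m"
      using n[of m] by (auto simp: fps_supp_def coeff_sum)
  qed
  with assms show False by blast
qed

lemma filterlim_card_below:
  assumes "infinite (S :: nat set)"
  shows "filterlim (\<lambda>N. real (card (S \<inter> {..<N}))) at_top sequentially"
proof -
  have "filterlim (\<lambda>N. card (S \<inter> {..<N})) at_top sequentially"
    unfolding filterlim_at_top eventually_sequentially
  proof
    fix Z
    obtain T where T: "T \<subseteq> S" "card T = Z" "finite T" using assms infinite_arbitrarily_large by blast
    obtain N where "T \<subseteq> {..<N}" using T(3) finite_nat_bounded by blast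
    then have "Z \<le> card (S \<inter> {..<M})" if "M \<ge> N" for M
      using that T by (metis (no_types, lifting) card_mono finite_Int finite_lessThan le_inf_iff lessThan_subset_iff order.trans)
    then show "\<exists>N. \<forall>n\<ge>N. Z \<le> card (S \<inter> {..<n})" by blast
  qed
  then show ?thesis by (rule filterlim_compose[OF filterlim_real_sequentially])
qed

subsection \<open>Growth of the counting functions\<close>

locale sparse_power_series =
  fixes A r :: nat and f :: "nat \<Rightarrow> real fps"
  assumes A_pos: "A \<ge> 1" and r_ge_2: "r \<ge> 2"
    and integral: "\<And>i n. i \<in> {1..r} \<Longrightarrow> fps_nth (f i) n \<in> \<int>"
    and nonpolynomial: "\<And>i. i \<in> {1..r} \<Longrightarrow> f i \<notin> range fps_of_poly"
    and bounded: "\<exists>C. \<forall>i\<in>{1..r}. \<forall>n. 0 \<le> fps_nth (f i) n \<and> fps_nth (f i) n \<le> C"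
    and gaps: "\<And>k :: nat \<Rightarrow> nat. (r = 2 \<longrightarrow> k 1 \<le> A - 1) \<and> (r \<ge> 3 \<longrightarrow> k 1 \<le> A) \<Longrightarrow>
      (\<lambda>R. R - real (last_below R
          ((\<Sum>h=1..r-2. sumset_power (k h) (fps_supp (f h)))
            + sumset_power (1 + k (r - 1)) (fps_supp (f (r - 1))))))
        \<in> o(\<lambda>R. R / (\<Prod>h=1..r. real (count_below (fps_supp (f h)) R) ^ k h))"
    and growth_first: "\<exists>\<delta>>0.
      (\<lambda>R. real (count_below (fps_supp (f 1)) R)) \<in> o(\<lambda>R. R powr (- \<delta> + 1 / real A))"
    and growth_next: "\<And>i \<epsilon>. i \<in> {2..r} \<Longrightarrow> \<epsilon> > 0 \<Longrightarrow>
      (\<lambda>R. real (count_below (fps_supp (f i)) R))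
        \<in> o(\<lambda>R. real (count_below (fps_supp (f (i - 1))) R) powr \<epsilon>)"
    and dense_last: "\<exists>C>0. \<exists>R0>0. \<forall>R\<ge>R0. {R..C * R} \<inter> real ` fps_supp (f r) \<noteq> {}"
begin

definition cnt :: "nat \<Rightarrow> nat \<Rightarrow> real" where
  "cnt h N = real (card (fps_supp (f h) \<inter> {..<N}))"

lemma count_below_of_nat: "real (count_below (fps_supp (f h)) (real N)) = cnt h N"
proof -
  have "{n \<in> fps_supp (f h). real n < real N} = fps_supp (f h) \<inter> {..<N}" by auto
  then show ?thesis by (simp add: count_below_def cnt_def)
qed

lemma nonneg: "i \<in> {1..r} \<Longrightarrow> fps_nth (f i) n \<ge> 0"
  using bounded by blast

lemma cnt_at_top: "h \<in> {1..r} \<Longrightarrow> filterlim (cnt h) at_top sequentially"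
  using filterlim_card_below[OF infinite_fps_supp[OF nonpolynomial[of h]]] by (simp add: cnt_def[abs_def])

lemma cnt_ge_1: "h \<in> {1..r} \<Longrightarrow> \<forall>\<^sub>F N in sequentially. cnt h N \<ge> 1"
  using cnt_at_top unfolding filterlim_at_top by blast

lemma cnt_all_ge_1: "\<forall>\<^sub>F N in sequentially. \<forall>h\<in>{1..r}. cnt h N \<ge> 1"
  using cnt_ge_1 by (simp add: eventually_ball_finite)

lemma cnt_nonneg [simp]: "cnt h N \<ge> 0"
  by (simp add: cnt_def)

lemma eventually_le_of_smallo:
  fixes u v :: "real \<Rightarrow> real"
  assumes "u \<in> o(v)" "\<epsilon> > 0"
  shows "\<forall>\<^sub>F N in sequentially. \<bar>u (real N)\<bar> \<le> \<epsilon> * \<bar>v (real N)\<bar>"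
  using eventually_compose_filterlim[OF landau_o.smallD[OF assms] filterlim_real_sequentially] by simp

lemma cnt_first_le: "\<exists>\<delta>>0. \<forall>\<^sub>F N in sequentially. cnt 1 N \<le> real N powr (1 / real A - \<delta>)"
proof -
  obtain \<delta> where d: "\<delta> > 0"
    "(\<lambda>R. real (count_below (fps_supp (f 1)) R)) \<in> o(\<lambda>R. R powr (- \<delta> + 1 / real A))"
    using growth_first by blast
  from eventually_le_of_smallo[OF d(2), of 1]
  have "\<forall>\<^sub>F N in sequentially. cnt 1 N \<le> real N powr (1 / real A - \<delta>)"
    by (simp add: count_below_of_nat algebra_simps)
  with d(1) show ?thesis by blast
qed

lemma cnt_next_le:
  assumes "i \<in> {2..r}" "\<epsilon> > 0"
  shows "\<forall>\<^sub>F N in sequentially. cnt i N \<le> cnt (i - 1) N powr \<epsilon>"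
  using eventually_le_of_smallo[OF growth_next[OF assms], of 1] by (simp add: count_below_of_nat)

text \<open>Induction on \<open>h\<close>: the exponent 1 suffices up to the predecessor, and
  \<open>\<epsilon>\<close> is spent in the last step.\<close>

lemma cnt_later_le:
  assumes "1 \<le> i" "i < h" "h \<le> r" "\<epsilon> > 0"
  shows "\<forall>\<^sub>F N in sequentially. cnt h N \<le> cnt i N powr \<epsilon>"
  using \<open>i < h\<close> \<open>h \<le> r\<close> \<open>\<epsilon> > 0\<close>
proof (induction h arbitrary: \<epsilon>)
  case (Suc h)
  show ?case
  proof (cases "i = h")
    case True
    then show ?thesis using cnt_next_le[of "Suc h" \<epsilon>] Suc.prems assms(1) by simp
  next
    case False
    then have "i < h" using Suc.prems by simp
    then have "\<forall>\<^sub>F N in sequentially. cnt h N \<le> cnt i N powr 1"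
      using Suc.prems by (intro Suc.IH) auto
    moreover have "\<forall>\<^sub>F N in sequentially. cnt (Suc h) N \<le> cnt h N powr \<epsilon>"
      using cnt_next_le[of "Suc h" \<epsilon>] Suc.prems assms(1) by simp
    ultimately show ?thesis
    proof eventually_elim
      case (elim N)
      have "cnt h N powr \<epsilon> \<le> cnt i N powr \<epsilon>"
        using elim(1) Suc.prems by (intro powr_mono2) auto
      with elim show ?case by simp
    qed
  qed
qed simp

lemma cnt_tail_le:
  assumes i: "i \<in> {1..r}" and e: "\<epsilon> > 0"
  shows "\<forall>\<^sub>F N in sequentially. (\<Prod>h\<in>{i<..r}. cnt h N ^ k h) \<le> cnt i N powr \<epsilon>"
proof -
  define s where "s = (\<Sum>h\<in>{i<..r}. k h)"
  \<comment> \<open>The exponents of all later factors add up to \<open>\<eta> * real s\<close>,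
    which must not exceed \<open>\<epsilon>\<close>; the 1 avoids division by zero.\<close>
  define \<eta> where "\<eta> = \<epsilon> / (real s + 1)"
  have eta: "\<eta> > 0" "\<eta> * real s \<le> \<epsilon>" using e by (auto simp: \<eta>_def field_simps)
  have "\<forall>\<^sub>F N in sequentially. \<forall>h\<in>{i<..r}. cnt h N \<le> cnt i N powr \<eta>"
    using cnt_later_le[of i _ \<eta>] i eta by (intro eventually_ball_finite) auto
  with cnt_ge_1[OF i] show ?thesis
  proof eventually_elim
    case (elim N)
    have "(\<Prod>h\<in>{i<..r}. cnt h N ^ k h) \<le> (\<Prod>h\<in>{i<..r}. (cnt i N powr \<eta>) ^ k h)"
      using elim by (intro prod_mono conjI power_mono) auto
    also have "\<dots> = (cnt i N powr \<eta>) ^ s" by (simp add: power_sum s_def)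
    also have "\<dots> = cnt i N powr (\<eta> * real s)"
      using elim by (simp add: powr_powr flip: powr_realpow)
    also have "\<dots> \<le> cnt i N powr \<epsilon>" using elim eta by (intro powr_mono) auto
    finally show ?case .
  qed
qed

lemma prod_split_at:
  assumes "i \<in> {1..r}"
  shows "(\<Prod>h=1..r. F h) = (\<Prod>h\<in>{1..<i}. F h) * F i * (\<Prod>h\<in>{i<..r}. F h :: 'b :: comm_monoid_mult)"
proof -
  have "{1..r} = ({1..<i} \<union> {i}) \<union> {i<..r}" using assms by auto
  also have "prod F \<dots> = (\<Prod>h\<in>{1..<i} \<union> {i}. F h) * (\<Prod>h\<in>{i<..r}. F h)"
    by (intro prod.union_disjoint) auto
  also have "(\<Prod>h\<in>{1..<i} \<union> {i}. F h) = (\<Prod>h\<in>{1..<i}. F h) * F i"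
    by (subst prod.union_disjoint) auto
  finally show ?thesis .
qed

text \<open>The first counting function, to the power \<open>A\<close>, saves the exponent
  \<open>A * \<delta>\<close>. Half of this pays for the other functions and half remains as
  \<open>d\<close>, which is the same for all monomials.\<close>

lemma cnt_prod_le: "\<exists>d>0. \<forall>k. k 1 \<le> A \<longrightarrow>
    (\<forall>\<^sub>F N in sequentially. (\<Prod>h=1..r. cnt h N ^ k h) \<le> real N powr (1 - d))"
proof -
  obtain \<delta> where d: "\<delta> > 0" "\<forall>\<^sub>F N in sequentially. cnt 1 N \<le> real N powr (1 / real A - \<delta>)"
    using cnt_first_le by blast
  have one: "1 \<in> {1..r}" using r_ge_2 by simp
  define d where "d = real A * \<delta> / 2"
  have dpos: "d > 0" using d A_pos by (simp add: d_def)
  show ?thesis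
  proof (intro exI conjI allI impI)
    fix k :: "nat \<Rightarrow> nat" assume k: "k 1 \<le> A"
    from d(2) cnt_ge_1[OF one] cnt_tail_le[OF one dpos, of k] eventually_ge_at_top[of 1]
    show "\<forall>\<^sub>F N in sequentially. (\<Prod>h=1..r. cnt h N ^ k h) \<le> real N powr (1 - d)"
    proof eventually_elim
      case (elim N)
      have c1: "cnt 1 N \<le> real N"
        using card_mono[of "{..<N}" "fps_supp (f 1) \<inter> {..<N}"] by (simp add: cnt_def)
      have "(\<Prod>h=1..r. cnt h N ^ k h) = cnt 1 N ^ k 1 * (\<Prod>h\<in>{1<..r}. cnt h N ^ k h)"
        using prod_split_at[OF one, of "\<lambda>h. cnt h N ^ k h"] by simp
      also have "\<dots> \<le> cnt 1 N ^ A * cnt 1 N powr d"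
        using elim k by (intro mult_mono power_increasing) (auto intro: prod_nonneg)
      also have "\<dots> \<le> (real N powr (1 / real A - \<delta>)) ^ A * real N powr d"
        using elim c1 dpos by (intro mult_mono power_mono powr_mono2) auto
      also have "(real N powr (1 / real A - \<delta>)) ^ A = real N powr ((1 / real A - \<delta>) * real A)"
        using elim by (simp add: powr_powr flip: powr_realpow)
      also have "(1 / real A - \<delta>) * real A = 1 - 2 * d" using A_pos by (simp add: d_def algebra_simps)
      also have "real N powr (1 - 2 * d) * real N powr d = real N powr (1 - d)"
        by (simp flip: powr_add)
      finally show ?case .
    qed
  qed (rule dpos)
qed

text \<open>For \<open>i < r - 1\<close> the factors after \<open>i\<close> together cost at most
  one more factor \<open>cnt i N\<close>, and \<open>k i < g i\<close> leaves room for it; for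
  \<open>i = r - 1\<close> the exponents compare one by one. The exponent on the right is that of
  the gap hypothesis, which itself adds one copy of the support at \<open>r - 1\<close>.\<close>

lemma lex_smaller_dominated:
  assumes i: "i \<in> {1..r-1}" and eq: "\<And>j. j \<in> {1..<i} \<Longrightarrow> k j = g j" and less: "k i < g i" and K: "k r \<le> K"
  shows "\<forall>\<^sub>F N in sequentially.
    (\<Prod>h=1..r. cnt h N ^ k h) \<le> (\<Prod>h=1..r. cnt h N ^ (g(r - 1 := g (r - 1) - 1, r := K)) h)"
proof (cases "i = r - 1")
  case True
  have le: "k h \<le> (g(r - 1 := g (r - 1) - 1, r := K)) h" if "h \<in> {1..r}" for h
  proof -
    have "h \<in> {1..<i} \<or> h = i \<or> h = r" using that True by (simp, linarith)
    then show ?thesis using eq[of h] less K True r_ge_2 by auto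
  qed
  from cnt_all_ge_1 show ?thesis
    by eventually_elim (intro prod_mono conjI power_increasing le zero_le_power cnt_nonneg; blast)
next
  case False
  then have i': "i \<in> {1..r}" "i < r - 1" using i by auto
  have "\<forall>\<^sub>F N in sequentially. (\<Prod>h\<in>{i<..r}. cnt h N ^ k h) \<le> cnt i N powr 1"
    using i'(1) by (rule cnt_tail_le) simp
  with cnt_all_ge_1 show ?thesis
  proof eventually_elim
    case (elim N)
    let ?\<kappa> = "g(r - 1 := g (r - 1) - 1, r := K)"
    have "(\<Prod>h=1..r. cnt h N ^ k h) = (\<Prod>h\<in>{1..<i}. cnt h N ^ k h) * cnt i N ^ k i * (\<Prod>h\<in>{i<..r}. cnt h N ^ k h)"
      by (rule prod_split_at[OF i'(1)])
    also have "\<dots> \<le> (\<Prod>h\<in>{1..<i}. cnt h N ^ k h) * cnt i N ^ k i * cnt i N"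
      using elim i'(1) by (intro mult_left_mono) (auto intro!: mult_nonneg_nonneg prod_nonneg)
    also have "\<dots> = (\<Prod>h\<in>{1..<i}. cnt h N ^ ?\<kappa> h) * cnt i N ^ Suc (k i)"
    proof -
      have "(\<Prod>h\<in>{1..<i}. cnt h N ^ k h) = (\<Prod>h\<in>{1..<i}. cnt h N ^ ?\<kappa> h)"
        using eq i' by (intro prod.cong) auto
      then show ?thesis by simp
    qed
    also have "\<dots> \<le> (\<Prod>h\<in>{1..<i}. cnt h N ^ ?\<kappa> h) * cnt i N ^ ?\<kappa> i"
      using elim i' less by (intro mult_left_mono power_increasing) (auto intro!: prod_nonneg)
    also have "\<dots> * 1 \<le> (\<Prod>h\<in>{1..<i}. cnt h N ^ ?\<kappa> h) * cnt i N ^ ?\<kappa> i * (\<Prod>h\<in>{i<..r}. cnt h N ^ ?\<kappa> h)"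
      using elim i' by (intro mult_left_mono prod_ge_1) (auto intro!: mult_nonneg_nonneg prod_nonneg one_le_power)
    also have "\<dots> = (\<Prod>h=1..r. cnt h N ^ ?\<kappa> h)"
      by (rule prod_split_at[OF i'(1), symmetric])
    finally show ?case by simp
  qed
qed

end

subsection \<open>Remainders of a linear relation\<close>

lemma conjugate_cmod_le_1:
  fixes Q :: "int poly"
  assumes "Pisot \<beta> \<or> Salem \<beta>" "lead_coeff Q = 1" "irreducible (of_int_poly Q :: rat poly)"
    "poly (of_int_poly Q) \<beta> = 0" "poly (of_int_poly Q) z = 0" "z \<noteq> of_real \<beta>"
  shows "cmod z \<le> 1"
proof -
  have "z \<in> conjugates \<beta>"
    unfolding conjugates_def using assms
    by (auto intro!: exI[of _ "of_int_poly Q"] simp: poly_of_rat_of_int_poly)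
  with assms(1,6) show ?thesis by (auto simp: Pisot_def Salem_def intro: less_imp_le)
qed

lemma poly_growth_absorb_const:
  obtains c where "\<And>m. D * (real m + 2) ^ b \<le> (real m + 2) ^ (b + c)"
proof -
  obtain c where c: "D \<le> 2 ^ c" using const_le_two_power by blast
  show ?thesis
  proof (rule that)
    fix m
    have "D \<le> (real m + 2) ^ c" by (rule order.trans[OF c power_mono]) auto
    then have "D * (real m + 2) ^ b \<le> (real m + 2) ^ c * (real m + 2) ^ b" by (intro mult_right_mono) auto
    then show "D * (real m + 2) ^ b \<le> (real m + 2) ^ (b + c)" by (simp add: power_add mult.commute)
  qed
qed

lemma fps_poly_growth_uniform:
  assumes "finite J" "\<And>k. k \<in> J \<Longrightarrow> fps_poly_growth (a k)"
  obtains b where "\<And>k n. k \<in> J \<Longrightarrow> \<bar>fps_nth (a k) n\<bar> \<le> (real n + 2) ^ b"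
proof -
  obtain b where b: "\<And>k n. k \<in> J \<Longrightarrow> \<bar>fps_nth (a k) n\<bar> \<le> (real n + 2) ^ b k"
    using assms(2) unfolding fps_poly_growth_def by metis
  show ?thesis
  proof (rule that[of "sum b J"])
    fix k n assume k: "k \<in> J"
    have "b k \<le> sum b J" using assms(1) k by (intro member_le_sum) auto
    then have "(real n + 2) ^ b k \<le> (real n + 2) ^ sum b J" by (intro power_increasing) auto
    with b[OF k, of n] show "\<bar>fps_nth (a k) n\<bar> \<le> (real n + 2) ^ sum b J" by linarith
  qed
qed

text \<open>Because the whole series vanishes, the partial sum is minus a tail, whose decay offsets
  the factor \<open>\<beta> ^ m\<close>.\<close>

lemma remainder_upper_bound:
  fixes w :: "nat \<Rightarrow> real"
  assumes beta: "\<beta> > 1" and w: "\<And>n. \<bar>w n\<bar> \<le> (real n + 2) ^ b" and sums: "(\<lambda>n. w n * inverse \<beta> ^ n) sums 0"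
  obtains B where "\<And>m. \<bar>\<Sum>i\<le>m. w i * \<beta> ^ (m - i)\<bar> \<le> (real m + 2) ^ B"
proof -
  define x where "x = inverse \<beta>"
  have x: "0 < x" "x < 1" "\<beta> * x = 1" using beta by (auto simp: x_def inverse_less_1_iff)
  have smb: "summable (\<lambda>n. (real n + 2) ^ b * x ^ n)" using x by (intro summable_power_growth) auto
  define T where "T = (\<Sum>n. (real n + 2) ^ b * x ^ n)"
  have le: "\<bar>\<Sum>i\<le>m. w i * \<beta> ^ (m - i)\<bar> \<le> T * (real m + 2) ^ b" for m
  proof -
    have "(\<Sum>i\<le>m. w i * \<beta> ^ (m - i)) = \<beta> ^ m * (\<Sum>i<Suc m. w i * x ^ i)"
      unfolding sum_distrib_left lessThan_Suc_atMost
    proof (rule sum.cong)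
      fix i assume "i \<in> {..m}"
      then have "\<beta> ^ m * x ^ i = \<beta> ^ (m - i) * (\<beta> * x) ^ i"
        by (simp add: power_mult_distrib flip: mult.assoc power_add)
      then show "w i * \<beta> ^ (m - i) = \<beta> ^ m * (w i * x ^ i)" using x(3) by simp
    qed simp
    also have "(\<Sum>i<Suc m. w i * x ^ i) = - (\<Sum>n. w (n + Suc m) * x ^ (n + Suc m))"
      using suminf_minus_initial_segment[of "\<lambda>n. w n * x ^ n" "Suc m"] sums
      by (simp add: sums_iff x_def)
    also have "\<bar>\<beta> ^ m * - (\<Sum>n. w (n + Suc m) * x ^ (n + Suc m))\<bar> = \<beta> ^ m * \<bar>\<Sum>n. w (n + Suc m) * x ^ (n + Suc m)\<bar>"
      using beta by (simp add: abs_mult)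
    also have "\<dots> \<le> \<beta> ^ m * (\<Sum>n. (real m + 2) ^ b * x ^ m * ((real n + 2) ^ b * x ^ n))"
    proof (intro mult_left_mono)
      have bd: "norm (w (n + Suc m) * x ^ (n + Suc m)) \<le> (real m + 2) ^ b * x ^ m * ((real n + 2) ^ b * x ^ n)" for n
      proof -
        have "norm (w (n + Suc m) * x ^ (n + Suc m)) \<le> (real (n + Suc m) + 2) ^ b * x ^ (n + Suc m)"
          using w[of "n + Suc m"] x by (simp add: abs_mult mult_right_mono)
        \<comment> \<open>\<open>n + m + 3 \<le> (m + 2) * (n + 2)\<close> separates a power of
          \<open>m + 2\<close> from a summable series in \<open>n\<close>.\<close>
        also have "\<dots> \<le> ((real m + 2) * (real n + 2)) ^ b * x ^ (n + m)"
          using x by (intro mult_mono power_mono power_decreasing) (auto simp: algebra_simps)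
        finally show ?thesis by (simp add: power_mult_distrib power_add mult_ac)
      qed
      have sm: "summable (\<lambda>n. (real m + 2) ^ b * x ^ m * ((real n + 2) ^ b * x ^ n))"
        using smb by (rule summable_mult)
      have sn: "summable (\<lambda>n. norm (w (n + Suc m) * x ^ (n + Suc m)))"
        by (rule summable_comparison_test'[OF sm, where N = 0]) (use bd in simp)
      from order.trans[OF summable_norm[OF sn] suminf_le[OF bd sn sm]]
      show "\<bar>\<Sum>n. w (n + Suc m) * x ^ (n + Suc m)\<bar> \<le> (\<Sum>n. (real m + 2) ^ b * x ^ m * ((real n + 2) ^ b * x ^ n))"
        unfolding real_norm_def .
    qed (use beta in auto)
    also have "\<dots> = \<beta> ^ m * ((real m + 2) ^ b * x ^ m * T)"
      unfolding T_def by (subst suminf_mult[OF smb]) simp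
    also have "\<dots> = (\<beta> * x) ^ m * (T * (real m + 2) ^ b)" by (simp only: power_mult_distrib mult_ac)
    finally show ?thesis using x(3) by simp
  qed
  obtain c where c: "\<And>m. T * (real m + 2) ^ b \<le> (real m + 2) ^ (b + c)"
    using poly_growth_absorb_const by blast
  show ?thesis by (rule that[of "b + c"]) (use le c order.trans in blast)
qed

text \<open>The remainder at \<open>m\<close> is an integer polynomial evaluated at \<beta>. At
  every other conjugate, of absolute value at most 1, this polynomial is a sum over
  \<open>m + 1\<close> indices of terms of polynomial size, so the norm gives \<open>lower\<close>;
  \<open>upper\<close> comes from the vanishing of the series.\<close>

lemma beta_remainders_exist:
  fixes a :: "'k \<Rightarrow> real fps" and p :: "'k \<Rightarrow> int poly"
  assumes PS: "Pisot \<beta> \<or> Salem \<beta>" and J: "finite J"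
    and growth: "\<And>k. k \<in> J \<Longrightarrow> fps_poly_growth (a k)"
    and ints: "\<And>k n. k \<in> J \<Longrightarrow> fps_nth (a k) n \<in> \<int>"
    and relation: "(\<Sum>k\<in>J. poly (of_int_poly (p k)) \<beta> * eval_fps (a k) (inverse \<beta>)) = 0"
  shows "\<exists>Y B. beta_remainders \<beta> (\<lambda>m. \<Sum>k\<in>J. poly (of_int_poly (p k)) \<beta> * fps_nth (a k) m) Y B"
proof -
  define w where "w m = (\<Sum>k\<in>J. poly (of_int_poly (p k)) \<beta> * fps_nth (a k) m)" for m
  define Y where "Y m = - (\<Sum>i\<le>m. w i * \<beta> ^ (m - i))" for m
  have beta: "\<beta> > 1" "algebraic_int \<beta>" using PS by (auto simp: Pisot_def Salem_def)
  obtain Q :: "int poly" where Q: "lead_coeff Q = 1" "irreducible (of_int_poly Q :: rat poly)" "poly (of_int_poly Q) \<beta> = 0"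
    using algebraic_int_minimal_polynomial[OF beta(2)] by metis
  obtain b where b: "\<And>k n. k \<in> J \<Longrightarrow> \<bar>fps_nth (a k) n\<bar> \<le> (real n + 2) ^ b"
    using fps_poly_growth_uniform[of J a] J growth by blast
  have rec: "Y (Suc m) = \<beta> * Y m - w (Suc m)" for m
  proof -
    have "(\<Sum>i\<le>m. w i * \<beta> ^ (Suc m - i)) = \<beta> * (\<Sum>i\<le>m. w i * \<beta> ^ (m - i))"
      unfolding sum_distrib_left by (rule sum.cong) (auto simp: Suc_diff_le)
    then show ?thesis by (simp add: Y_def)
  qed
  have "\<exists>B1. \<forall>m. \<bar>Y m\<bar> \<le> (real m + 2) ^ B1"
  proof -
    define D where "D = (\<Sum>k\<in>J. \<bar>poly (of_int_poly (p k)) \<beta>\<bar>)"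
    have "\<bar>w m\<bar> \<le> D * (real m + 2) ^ b" for m
    proof -
      have "\<bar>w m\<bar> \<le> (\<Sum>k\<in>J. \<bar>poly (of_int_poly (p k)) \<beta> * fps_nth (a k) m\<bar>)"
        unfolding w_def by (rule sum_abs)
      also have "\<dots> \<le> (\<Sum>k\<in>J. \<bar>poly (of_int_poly (p k)) \<beta>\<bar> * (real m + 2) ^ b)"
        unfolding abs_mult by (intro sum_mono mult_left_mono b) auto
      finally show ?thesis by (simp add: D_def sum_distrib_right)
    qed
    moreover obtain c where "\<And>m. D * (real m + 2) ^ b \<le> (real m + 2) ^ (b + c)"
      using poly_growth_absorb_const by blast
    ultimately have "\<bar>w m\<bar> \<le> (real m + 2) ^ (b + c)" for m by (meson order.trans)
    moreover have "(\<lambda>n. w n * inverse \<beta> ^ n) sums 0"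
    proof -
      have "(\<lambda>n. \<Sum>k\<in>J. poly (of_int_poly (p k)) \<beta> * (fps_nth (a k) n * inverse \<beta> ^ n)) sums
          (\<Sum>k\<in>J. poly (of_int_poly (p k)) \<beta> * eval_fps (a k) (inverse \<beta>))"
        using beta by (intro sums_sum sums_mult sums_fps_poly_growth growth) (auto simp: inverse_less_1_iff)
      then show ?thesis by (simp add: relation w_def sum_distrib_right mult.assoc)
    qed
    ultimately show ?thesis
      using remainder_upper_bound[OF beta(1)] unfolding Y_def abs_minus_cancel by metis
  qed
  then obtain B1 where B1: "\<And>m. \<bar>Y m\<bar> \<le> (real m + 2) ^ B1" by blast
  have "\<exists>e. \<forall>m. Y m \<noteq> 0 \<longrightarrow> 1 \<le> \<bar>Y m\<bar> * ((real m + 2) ^ e) ^ degree Q"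
  proof -
    define \<iota> where "\<iota> k i = \<lfloor>fps_nth (a k) i\<rfloor>" for k i
    have \<iota>: "of_int (\<iota> k i) = fps_nth (a k) i" if "k \<in> J" for k i
      using ints[OF that, of i] by (simp add: \<iota>_def)
    \<comment> \<open>The formula for \<open>Y m\<close> with an indeterminate in place of \<beta>,
      so that it can also be evaluated at the conjugates.\<close>
    define q where "q m = - (\<Sum>i\<le>m. \<Sum>k\<in>J. [:\<iota> k i:] * p k * Polynomial.monom 1 (m - i))" for m
    have q_eval: "poly (of_int_poly (q m)) z =
        - (\<Sum>i\<le>m. \<Sum>k\<in>J. of_int (\<iota> k i) * poly (of_int_poly (p k)) z * z ^ (m - i))" for m and z :: "'c :: field_char_0"
      by (simp add: q_def hom_distribs poly_sum poly_monom mult.assoc)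
    have qY: "poly (of_int_poly (q m)) \<beta> = Y m" for m
      unfolding q_eval Y_def w_def sum_distrib_right by (simp add: \<iota> mult_ac)
    define Z where "Z = {z :: complex. poly (of_int_poly Q) z = 0}"
    have finZ: "finite Z" unfolding Z_def using Q(1) by (intro poly_roots_finite) auto
    define D where "D = (\<Sum>k\<in>J. \<Sum>z\<in>Z. cmod (poly (of_int_poly (p k)) z))"
    have bound: "cmod (poly (of_int_poly (q m)) z) \<le> D * (real m + 2) ^ (b + 1)"
      if z: "z \<in> Z" "z \<noteq> of_real \<beta>" for m z
    proof -
      have z1: "cmod z \<le> 1" using conjugate_cmod_le_1[OF PS Q] z by (simp add: Z_def)
      have "cmod (poly (of_int_poly (q m)) z) \<le> (\<Sum>i\<le>m. \<Sum>k\<in>J. cmod (of_int (\<iota> k i) * poly (of_int_poly (p k)) z * z ^ (m - i)))"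
        unfolding q_eval norm_minus_cancel by (intro order.trans[OF norm_sum] sum_mono norm_sum)
      also have "\<dots> \<le> (\<Sum>i\<le>m. \<Sum>k\<in>J. (real m + 2) ^ b * (\<Sum>z\<in>Z. cmod (poly (of_int_poly (p k)) z)))"
      proof (intro sum_mono)
        fix i k assume ik: "i \<in> {..m}" "k \<in> J"
        have "cmod (of_int (\<iota> k i)) = \<bar>fps_nth (a k) i\<bar>"
          using \<iota>[OF ik(2), of i] by (metis norm_of_int)
        also have "\<dots> \<le> (real m + 2) ^ b"
          using ik by (intro order.trans[OF b[OF ik(2)]] power_mono) auto
        finally have 1: "cmod (of_int (\<iota> k i)) \<le> (real m + 2) ^ b" .
        have 2: "cmod (poly (of_int_poly (p k)) z) \<le> (\<Sum>z\<in>Z. cmod (poly (of_int_poly (p k)) z))"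
          using finZ z(1) by (intro member_le_sum) auto
        have 3: "cmod (z ^ (m - i)) \<le> 1" using z1 by (simp add: norm_power power_le_one)
        have "cmod (of_int (\<iota> k i) * poly (of_int_poly (p k)) z * z ^ (m - i))
            \<le> (real m + 2) ^ b * (\<Sum>z\<in>Z. cmod (poly (of_int_poly (p k)) z)) * 1"
          unfolding norm_mult by (intro mult_mono 1 2 3 mult_nonneg_nonneg sum_nonneg) auto
        then show "cmod (of_int (\<iota> k i) * poly (of_int_poly (p k)) z * z ^ (m - i))
            \<le> (real m + 2) ^ b * (\<Sum>z\<in>Z. cmod (poly (of_int_poly (p k)) z))" by simp
      qed
      also have "\<dots> = (real m + 1) * ((real m + 2) ^ b * D)"
        by (simp add: D_def sum_distrib_left add.commute)
      also have "\<dots> \<le> (real m + 2) * ((real m + 2) ^ b * D)"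
        by (intro mult_right_mono mult_nonneg_nonneg) (auto simp: D_def intro!: sum_nonneg)
      finally show ?thesis by (simp add: mult_ac)
    qed
    obtain c where c: "\<And>m. D * (real m + 2) ^ (b + 1) \<le> (real m + 2) ^ (b + 1 + c)"
      using poly_growth_absorb_const by blast
    have "1 \<le> \<bar>Y m\<bar> * ((real m + 2) ^ (b + 1 + c)) ^ degree Q" if "Y m \<noteq> 0" for m
      unfolding qY[symmetric]
    proof (rule norm_lower_bound[OF Q])
      show "poly (of_int_poly (q m)) \<beta> \<noteq> 0" using that qY by simp
      show "cmod (poly (of_int_poly (q m)) z) \<le> (real m + 2) ^ (b + 1 + c)"
        if "poly (of_int_poly Q) z = 0" "z \<noteq> of_real \<beta>" for z
        using order.trans[OF bound c] that unfolding Z_def by blast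
      show "1 \<le> (real m + 2) ^ (b + 1 + c)" by (rule one_le_power) simp
    qed
    then show ?thesis by blast
  qed
  then obtain e where e: "\<And>m. Y m \<noteq> 0 \<Longrightarrow> 1 \<le> \<bar>Y m\<bar> * (real m + 2) ^ (e * degree Q)"
    unfolding power_mult by blast
  \<comment> \<open>The sum of the two exponents serves both bounds, the base being at least
    1.\<close>
  have "beta_remainders \<beta> w Y (B1 + e * degree Q)"
  proof
    fix m
    show "\<bar>Y m\<bar> \<le> (real m + 2) ^ (B1 + e * degree Q)"
      by (rule order.trans[OF B1 power_increasing]) auto
    assume "Y m \<noteq> 0"
    then have "1 \<le> \<bar>Y m\<bar> * (real m + 2) ^ (e * degree Q)" by (rule e)
    also have "\<dots> \<le> \<bar>Y m\<bar> * (real m + 2) ^ (B1 + e * degree Q)"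
      by (intro mult_left_mono power_increasing) auto
    finally show "1 \<le> \<bar>Y m\<bar> * (real m + 2) ^ (B1 + e * degree Q)" .
  qed (use beta rec in auto)
  then show ?thesis unfolding w_def by blast
qed

subsection \<open>The leading term of a linear relation\<close>

context sparse_power_series
begin

definition fprod :: "(nat \<Rightarrow> nat) \<Rightarrow> real fps" where
  "fprod k = (\<Prod>i=1..r. f i ^ k i)"

lemma growth: "i \<in> {1..r} \<Longrightarrow> fps_poly_growth (f i)"
proof -
  assume i: "i \<in> {1..r}"
  obtain C where "\<And>n. 0 \<le> fps_nth (f i) n \<and> fps_nth (f i) n \<le> C" using bounded i by blast
  then show ?thesis by (intro fps_poly_growth_bounded[of _ C]) auto
qed

lemma fprod_growth: "fps_poly_growth (fprod k)"
  unfolding fprod_def by (intro fps_poly_growth_prod fps_poly_growth_power growth)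

lemma fprod_Ints: "fps_nth (fprod k) n \<in> \<int>"
  unfolding fprod_def by (intro fps_Ints_prod fps_Ints_power integral)

lemma fprod_nonneg: "fps_nth (fprod k) n \<ge> 0"
  unfolding fprod_def by (intro fps_nonneg_prod fps_nonneg_power nonneg)

lemma fprod_ge_1: "n \<in> fps_supp (fprod k) \<Longrightarrow> fps_nth (fprod k) n \<ge> 1"
  using fprod_Ints[of k n] fprod_nonneg[of k n] by (auto simp: fps_supp_def elim!: Ints_cases)

lemma fprod_split_last: "fprod k = (\<Prod>i=1..r-1. f i ^ k i) * f r ^ k r"
proof -
  have "{1..r} = insert r {1..r-1}" using r_ge_2 by auto
  then show ?thesis using r_ge_2 by (simp add: fprod_def mult.commute)
qed

lemma card_fprod_le: "real (card (fps_supp (fprod k) \<inter> {..<N})) \<le> (\<Prod>h=1..r. cnt h N ^ k h)"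
proof -
  have "card (fps_supp (fprod k) \<inter> {..<N}) \<le> (\<Prod>h=1..r. card (fps_supp (f h) \<inter> {..<N}) ^ k h)"
    unfolding fprod_def by (intro card_fps_supp_prod_power_le nonneg) auto
  then have "real (card (fps_supp (fprod k) \<inter> {..<N})) \<le> real (\<Prod>h=1..r. card (fps_supp (f h) \<inter> {..<N}) ^ k h)"
    by (rule of_nat_mono)
  then show ?thesis by (simp add: cnt_def)
qed

lemma prefix_nonneg: "fps_nth (\<Prod>i=1..r-1. f i ^ g i) n \<ge> 0"
  by (intro fps_nonneg_prod fps_nonneg_power nonneg) auto

lemma prefix_nonempty:
  assumes "g (r - 1) \<ge> 1"
  shows "fps_supp (\<Prod>i=1..r-1. f i ^ g i) \<noteq> {}"
proof -
  have "fps_supp (f i) \<noteq> {}" if "i \<in> {1..r-1}" for i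
  proof -
    have "i \<in> {1..r}" using that by auto
    then show ?thesis using infinite_fps_supp[OF nonpolynomial[of i]] by auto
  qed
  then have "f i \<noteq> 0" if "i \<in> {1..r-1}" for i
    using that by (force simp: fps_supp_def)
  then have "(\<Prod>i=1..r-1. f i ^ g i) \<noteq> 0" by simp
  then show ?thesis by (auto simp: fps_supp_def fps_eq_iff)
qed

text \<open>The gap hypothesis for \<open>g\<close> lowered by one at \<open>r - 1\<close> concerns
  exactly the support of the prefix. The last exponent enters only the denominator, so
  \<open>K\<close> is free and can later dominate the last exponents of all monomials.\<close>

lemma prefix_gap:
  assumes g: "g (r - 1) \<ge> 1" "g 1 \<le> A" and \<epsilon>: "\<epsilon> > 0"
  shows "\<forall>\<^sub>F N in sequentially. \<exists>v\<in>fps_supp (\<Prod>i=1..r-1. f i ^ g i). v < N \<and>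
    real N - real v \<le> \<epsilon> * (real N / (\<Prod>h=1..r. cnt h N ^ (g(r - 1 := g (r - 1) - 1, r := K)) h))"
proof -
  define P where "P = fps_supp (\<Prod>i=1..r-1. f i ^ g i)"
  define \<kappa> where "\<kappa> = g(r - 1 := g (r - 1) - 1, r := K)"
  have P_eq: "(\<Sum>h=1..r-2. sumset_power (\<kappa> h) (fps_supp (f h))) + sumset_power (1 + \<kappa> (r - 1)) (fps_supp (f (r - 1))) = P"
  proof -
    have set_eq: "{1..r-1} = insert (r - 1) {1..r-2}" "r - 1 \<notin> {1..r-2}" using r_ge_2 by auto
    have "P = (\<Sum>h=1..r-1. fps_supp (f h ^ g h))"
      unfolding P_def by (intro fps_supp_prod fps_nonneg_power nonneg) auto
    also have "\<dots> = (\<Sum>h=1..r-1. sumset_power (g h) (fps_supp (f h)))"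
      by (intro sum.cong fps_supp_power nonneg) auto
    also have "\<dots> = sumset_power (g (r - 1)) (fps_supp (f (r - 1))) + (\<Sum>h=1..r-2. sumset_power (g h) (fps_supp (f h)))"
      unfolding set_eq(1) using set_eq(2) by (intro sum.insert) auto
    also have "(\<Sum>h=1..r-2. sumset_power (g h) (fps_supp (f h))) = (\<Sum>h=1..r-2. sumset_power (\<kappa> h) (fps_supp (f h)))"
      by (intro sum.cong) (auto simp: \<kappa>_def)
    also have "g (r - 1) = 1 + \<kappa> (r - 1)"
    proof -
      have "r - 1 \<noteq> r" using r_ge_2 by linarith
      then show ?thesis using g by (simp add: \<kappa>_def)
    qed
    finally show ?thesis by (simp only: add.commute)
  qed
  \<comment> \<open>For \<open>r = 2\<close> the lowered index is 1 itself, which yields the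
    stricter bound.\<close>
  have "(r = 2 \<longrightarrow> \<kappa> 1 \<le> A - 1) \<and> (r \<ge> 3 \<longrightarrow> \<kappa> 1 \<le> A)"
    using g by (auto simp: \<kappa>_def)
  from eventually_le_of_smallo[OF gaps[of \<kappa>, OF this] \<epsilon>, unfolded P_eq]
  have ev: "\<forall>\<^sub>F N in sequentially. \<bar>real N - real (last_below (real N) P)\<bar> \<le> \<epsilon> * \<bar>real N / (\<Prod>h=1..r. cnt h N ^ \<kappa> h)\<bar>"
    by (simp add: count_below_of_nat)
  \<comment> \<open>\<open>last_below\<close> is a genuine maximum only beyond some point of
    \<open>P\<close>.\<close>
  obtain v0 where v0: "v0 \<in> P" using prefix_nonempty[of g] g unfolding P_def by blast
  show ?thesis
    using ev eventually_gt_at_top[of v0] unfolding P_def[symmetric] \<kappa>_def[symmetric]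
  proof eventually_elim
    case (elim N)
    have f: "finite {n \<in> P. real n < real N}" "{n \<in> P. real n < real N} \<noteq> {}"
      using v0 elim(2) by auto
    have "last_below (real N) P \<in> {n \<in> P. real n < real N}"
      unfolding last_below_def by (rule Max_in[OF f])
    moreover have "\<bar>real N / (\<Prod>h=1..r. cnt h N ^ \<kappa> h)\<bar> = real N / (\<Prod>h=1..r. cnt h N ^ \<kappa> h)"
      by (intro abs_of_nonneg divide_nonneg_nonneg prod_nonneg) auto
    ultimately show ?case using elim(1) by (intro bexI[of _ "last_below (real N) P"]) auto
  qed
qed

lemma dense_last_nat:
  obtains C where "\<forall>\<^sub>F n in sequentially. \<exists>s\<in>fps_supp (f r). 0 < s \<and> n \<le> C * s \<and> 2 * s \<le> n"
proof -
  obtain C R0 where C: "C > 0" "R0 > 0" "\<And>R. R \<ge> R0 \<Longrightarrow> {R..C * R} \<inter> real ` fps_supp (f r) \<noteq> {}"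
    using dense_last by blast
  show ?thesis
  proof (rule that[of "nat \<lceil>2 * C\<rceil>"])
    show "\<forall>\<^sub>F n in sequentially. \<exists>s\<in>fps_supp (f r). 0 < s \<and> n \<le> nat \<lceil>2 * C\<rceil> * s \<and> 2 * s \<le> n"
      using eventually_ge_at_top[of "nat \<lceil>2 * C * R0\<rceil>"]
    proof eventually_elim
      case (elim n)
      then have n: "real n \<ge> 2 * C * R0" by linarith
      \<comment> \<open>The density interval becomes \<open>[n / (2 * C), n / 2]\<close>.\<close>
      define R where "R = real n / (2 * C)"
      have R: "R \<ge> R0" "C * R = real n / 2" using n C by (simp_all add: R_def field_simps)
      obtain s where s: "s \<in> fps_supp (f r)" "R \<le> real s" "real s \<le> C * R"
        using C(3)[OF R(1)] by auto
      have "real n = 2 * C * R" using C by (simp add: R_def)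
      also have "\<dots> \<le> 2 * C * real s" using s C by simp
      also have "\<dots> \<le> real (nat \<lceil>2 * C\<rceil>) * real s" by (intro mult_right_mono) linarith+
      finally have "real n \<le> real (nat \<lceil>2 * C\<rceil> * s)" by simp
      then have "n \<le> nat \<lceil>2 * C\<rceil> * s" by (simp only: of_nat_le_iff)
      moreover have "2 * s \<le> n" using s R by linarith
      moreover have "0 < s" using s R C by linarith
      ultimately show ?case using s(1) by blast
    qed
  qed
qed

text \<open>Supplies the data of \<open>sparse_digits_contradiction\<close>.
  \<open>g (r - 1) \<ge> 1\<close> makes the gap hypothesis applicable to the prefix, and
  \<open>g r \<ge> 1\<close> puts the prefix support into \<open>U2\<close>.\<close>

lemma no_leading_relation:
  fixes p :: "(nat \<Rightarrow> nat) \<Rightarrow> int poly"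
  assumes PS: "Pisot \<beta> \<or> Salem \<beta>" and J: "finite J" "g \<in> J"
    and lex: "\<And>k. k \<in> J \<Longrightarrow> k \<noteq> g \<Longrightarrow> \<exists>i\<in>{1..r}. (\<forall>j\<in>{1..<i}. k j = g j) \<and> k i < g i"
    and g: "g (r - 1) \<ge> 1" "g r \<ge> 1" "g 1 \<le> A" and pos: "poly (of_int_poly (p g)) \<beta> > 0"
    and relation: "(\<Sum>k\<in>J. poly (of_int_poly (p k)) \<beta> * eval_fps (fprod k) (inverse \<beta>)) = 0"
  shows False
proof -
  define w where "w m = (\<Sum>k\<in>J. poly (of_int_poly (p k)) \<beta> * fps_nth (fprod k) m)" for m
  obtain Y B where "beta_remainders \<beta> w Y B"
    using beta_remainders_exist[OF PS J(1) fprod_growth fprod_Ints relation] unfolding w_def by blast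
  then interpret beta_remainders \<beta> w Y B .
  define pre where "pre = (\<Prod>i=1..r-1. f i ^ g i)"
  define J1 where "J1 = {k \<in> J. \<exists>i\<in>{1..r-1}. (\<forall>j\<in>{1..<i}. k j = g j) \<and> k i < g i}"
  define U1 where "U1 = (\<Union>k\<in>J1. fps_supp (fprod k))"
  define U2 where "U2 = (\<Union>j<g r. fps_supp (pre * f r ^ j))"
  define G where "G = fps_supp (fprod g)"
  \<comment> \<open>Some upper bound for the last exponents occurring in \<open>J\<close> is wanted;
    the sum is one.\<close>
  define K where "K = (\<Sum>k\<in>J. k r)"
  define \<kappa> where "\<kappa> = g(r - 1 := g (r - 1) - 1, r := K)"
  define F where "F N = real N / (\<Prod>h=1..r. cnt h N ^ \<kappa> h)" for N
  have r1: "r \<in> {1..r}" using r_ge_2 by simp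
  have G_eq: "G = fps_supp (pre * f r ^ g r)" by (simp add: G_def pre_def fprod_split_last)
  obtain d where d: "d > 0" "\<And>k. k 1 \<le> A \<Longrightarrow>
      \<forall>\<^sub>F N in sequentially. (\<Prod>h=1..r. cnt h N ^ k h) \<le> real N powr (1 - d)"
    using cnt_prod_le by blast
  have \<kappa>1: "\<kappa> 1 \<le> A" using g(3) r_ge_2 by (auto simp: \<kappa>_def)
  obtain C4 where C4: "\<forall>\<^sub>F n in sequentially. \<exists>s\<in>fps_supp (f r). 0 < s \<and> n \<le> C4 * s \<and> 2 * s \<le> n"
    by (rule dense_last_nat)
  have finJ1: "finite J1" using J by (simp add: J1_def)
  have support: "fps_supp (fprod k) \<subseteq> U1 \<union> U2" if k: "k \<in> J" "k \<noteq> g" for k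
  proof (cases "k \<in> J1")
    case False
    then obtain i where i: "i \<in> {1..r}" "\<forall>j\<in>{1..<i}. k j = g j" "k i < g i" "i \<notin> {1..r-1}"
      using lex[OF k] k by (auto simp: J1_def)
    \<comment> \<open>The first difference is at the last index: the same prefix with a smaller
      power of \<open>f r\<close>.\<close>
    then have "i = r" by auto
    then have "(\<Prod>i=1..r-1. f i ^ k i) = pre"
      unfolding pre_def using i(2) by (intro prod.cong) auto
    then have "fprod k = pre * f r ^ k r" by (simp add: fprod_split_last)
    then show ?thesis using i \<open>i = r\<close> by (auto simp: U2_def)
  qed (auto simp: U1_def)
  have w_off: "w m = poly (of_int_poly (p g)) \<beta> * fps_nth (fprod g) m" if "m \<notin> U1" "m \<notin> U2" for m
  proof -
    have "fps_nth (fprod k) m = 0" if "k \<in> J" "k \<noteq> g" for k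
      using support[OF that] \<open>m \<notin> U1\<close> \<open>m \<notin> U2\<close> by (auto simp: fps_supp_def)
    then show ?thesis unfolding w_def by (subst sum.remove[OF J]) (simp add: sum.neutral)
  qed
  show False
  proof (rule sparse_digits_contradiction)
    show "poly (of_int_poly (p g)) \<beta> > 0" by (rule pos)
    show "w m = 0" if "m \<notin> U1" "m \<notin> U2" "m \<notin> G" for m
      using w_off[OF that(1,2)] that(3) by (simp add: G_def fps_supp_def)
    show "w m \<ge> poly (of_int_poly (p g)) \<beta>" if "m \<notin> U1" "m \<notin> U2" "m \<in> G" for m
      using w_off[OF that(1,2)] fprod_ge_1[of m g] that(3) pos by (simp add: G_def)
  next
    fix \<epsilon> :: real assume "\<epsilon> > 0"
    from prefix_gap[OF g(1,3) this, of K]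
    show "\<forall>\<^sub>F N in sequentially. \<exists>v\<in>U2. v < N \<and> real N - real v \<le> \<epsilon> * F N"
    proof eventually_elim
      case (elim N)
      have "fps_supp pre \<subseteq> U2" using g(2) by (force simp: U2_def intro: bexI[of _ 0])
      with elim show ?case unfolding F_def \<kappa>_def pre_def by blast
    qed
  next
    show "filterlim F at_top sequentially"
    \<comment> \<open>The exponent \<open>d\<close> saved in the product of counting functions
      becomes growth of \<open>F\<close>.\<close>
    proof (rule filterlim_at_top_mono)
      show "filterlim (\<lambda>N. real N powr d) at_top sequentially" using d(1) by real_asymp
      show "\<forall>\<^sub>F N in sequentially. real N powr d \<le> F N"
        using d(2)[of \<kappa>, OF \<kappa>1] cnt_all_ge_1 eventually_gt_at_top[of 0]
      proof eventually_elim
        case (elim N)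
        have "(\<Prod>h=1..r. cnt h N ^ \<kappa> h) > 0" using elim(2) by (intro prod_pos) force
        moreover have "real N powr d * (\<Prod>h=1..r. cnt h N ^ \<kappa> h) \<le> real N powr d * real N powr (1 - d)"
          using elim(1) by (intro mult_left_mono) auto
        moreover have "real N powr d * real N powr (1 - d) = real N" using elim(3) by (simp flip: powr_add)
        ultimately show ?case by (simp add: F_def pos_le_divide_eq)
      qed
    qed
  next
    show "\<forall>\<^sub>F n in sequentially. \<forall>u\<in>U2. \<exists>t\<in>U2 \<union> G. u < t \<and> n \<le> C4 * (t - u) \<and> 2 * (t - u) \<le> n"
      using C4
    proof eventually_elim
      case (elim n)
      then obtain s where s: "s \<in> fps_supp (f r)" "0 < s" "n \<le> C4 * s" "2 * s \<le> n" by blast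
      show ?case
      proof
        fix u assume "u \<in> U2"
        then obtain j where j: "j < g r" "u \<in> fps_supp (pre * f r ^ j)" by (auto simp: U2_def)
        have nn: "fps_nth (pre * f r ^ j) m \<ge> 0" for m
          unfolding pre_def using r1 by (intro fps_nonneg_mult prefix_nonneg fps_nonneg_power nonneg)
        \<comment> \<open>Adding \<open>s\<close> leads from one layer of \<open>U2\<close> to the
          next, or from the last layer to \<open>G\<close>.\<close>
        have "u + s \<in> fps_supp (pre * f r ^ j * f r)"
          using j s(1) nonneg[OF r1] nn by (subst fps_supp_mult) auto
        then have "u + s \<in> fps_supp (pre * f r ^ Suc j)" by (simp only: power_Suc2 mult.assoc)
        moreover have "Suc j < g r \<or> Suc j = g r" using j(1) by linarith
        ultimately have "u + s \<in> U2 \<union> G" unfolding U2_def G_eq by fastforce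
        then show "\<exists>t\<in>U2 \<union> G. u < t \<and> n \<le> C4 * (t - u) \<and> 2 * (t - u) \<le> n"
          using s by (intro bexI[of _ "u + s"]) auto
      qed
    qed
  next
    have "\<forall>\<^sub>F N in sequentially. \<forall>k\<in>J1. (\<Prod>h=1..r. cnt h N ^ k h) \<le> (\<Prod>h=1..r. cnt h N ^ \<kappa> h)"
    proof (intro eventually_ball_finite[OF finJ1] ballI)
      fix k assume k: "k \<in> J1"
      then obtain i where i: "i \<in> {1..r-1}" "\<forall>j\<in>{1..<i}. k j = g j" "k i < g i" by (auto simp: J1_def)
      have "k r \<le> K" unfolding K_def using k J by (intro member_le_sum) (auto simp: J1_def)
      with i show "\<forall>\<^sub>F N in sequentially. (\<Prod>h=1..r. cnt h N ^ k h) \<le> (\<Prod>h=1..r. cnt h N ^ \<kappa> h)"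
        unfolding \<kappa>_def by (intro lex_smaller_dominated) auto
    qed
    \<comment> \<open>One constant serves this bound and the next: \<open>card J1\<close> counts the
      monomials behind \<open>U1\<close>, \<open>g r\<close> the layers of \<open>U2\<close>, and 1
      covers the added point here and \<open>G\<close> there.\<close>
    with cnt_all_ge_1
    show "\<forall>\<^sub>F N in sequentially. (real (card (U1 \<inter> {..<N})) + 1) * F N \<le> (real (card J1) + real (g r) + 1) * real N"
    proof eventually_elim
      case (elim N)
      let ?L = "\<Prod>h=1..r. cnt h N ^ \<kappa> h"
      have L1: "?L \<ge> 1" using elim(1) by (intro prod_ge_1 one_le_power) auto
      have "U1 \<inter> {..<N} = (\<Union>k\<in>J1. fps_supp (fprod k) \<inter> {..<N})" by (auto simp: U1_def)
      then have "real (card (U1 \<inter> {..<N})) \<le> real (\<Sum>k\<in>J1. card (fps_supp (fprod k) \<inter> {..<N}))"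
        using card_UN_le[OF finJ1, of "\<lambda>k. fps_supp (fprod k) \<inter> {..<N}"] by (simp only: of_nat_le_iff)
      also have "\<dots> \<le> (\<Sum>k\<in>J1. ?L)"
        unfolding of_nat_sum using elim(2) by (intro sum_mono order.trans[OF card_fprod_le]) auto
      finally have "real (card (U1 \<inter> {..<N})) \<le> real (card J1) * ?L" by simp
      moreover have "0 \<le> real (g r) * ?L" using L1 by (intro mult_nonneg_nonneg) auto
      ultimately have "real (card (U1 \<inter> {..<N})) + 1 \<le> (real (card J1) + real (g r) + 1) * ?L"
        using L1 unfolding distrib_right by linarith
      then have "(real (card (U1 \<inter> {..<N})) + 1) * F N \<le> (real (card J1) + real (g r) + 1) * ?L * F N"
        using L1 by (intro mult_right_mono) (auto simp: F_def)
      also have "\<dots> = (real (card J1) + real (g r) + 1) * real N"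
      proof -
        have "a * l * (n / l) = a * n" if "l \<ge> 1" for a l n :: real using that by simp
        from this[OF L1] show ?thesis unfolding F_def .
      qed
      finally show ?case .
    qed
  next
    have "\<forall>\<^sub>F N in sequentially. \<forall>j\<in>{..g r}. (\<Prod>h=1..r. cnt h N ^ (g(r := j)) h) \<le> real N powr (1 - d)"
      using g(3) r_ge_2 by (intro eventually_ball_finite ballI d(2)) auto
    then show "\<forall>\<^sub>F N in sequentially. real (card (U2 \<inter> {..<N})) + real (card (G \<inter> {..<N}))
        \<le> (real (card J1) + real (g r) + 1) * real N powr (1 - d)"
    proof eventually_elim
      case (elim N)
      have le: "real (card (fps_supp (pre * f r ^ j) \<inter> {..<N})) \<le> real N powr (1 - d)" if "j \<le> g r" for j
      proof -
        have "(\<Prod>i=1..r-1. f i ^ (g(r := j)) i) = pre"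
          unfolding pre_def using r_ge_2 by (intro prod.cong) auto
        then have "fprod (g(r := j)) = pre * f r ^ j" by (simp add: fprod_split_last)
        then show ?thesis using card_fprod_le[of "g(r := j)" N] elim that by (auto intro: order.trans)
      qed
      have "U2 \<inter> {..<N} = (\<Union>j\<in>{..<g r}. fps_supp (pre * f r ^ j) \<inter> {..<N})" by (auto simp: U2_def)
      then have "real (card (U2 \<inter> {..<N})) \<le> real (\<Sum>j<g r. card (fps_supp (pre * f r ^ j) \<inter> {..<N}))"
        using card_UN_le[of "{..<g r}" "\<lambda>j. fps_supp (pre * f r ^ j) \<inter> {..<N}"] by (simp only: of_nat_le_iff finite_lessThan)
      also have "\<dots> \<le> (\<Sum>j<g r. real N powr (1 - d))"
        unfolding of_nat_sum by (intro sum_mono le) auto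
      finally have "real (card (U2 \<inter> {..<N})) \<le> real (g r) * real N powr (1 - d)" by simp
      moreover have "real (card (G \<inter> {..<N})) \<le> real N powr (1 - d)" unfolding G_eq by (rule le) simp
      moreover have "0 \<le> real (card J1) * real N powr (1 - d)" by simp
      ultimately show ?case unfolding distrib_right by linarith
    qed
  qed (use d in auto)
qed

end

section \<open>Reduction to a relation with positive leading coefficient\<close>

text \<open>Induction on the number of coordinates: among the elements agreeing with the previous
  maximum so far, one with the largest next coordinate is chosen. Full agreement stays possible,
  since coordinates beyond \<open>r\<close> may differ.\<close>

lemma lexicographic_maximum:
  fixes J :: "(nat \<Rightarrow> nat) set"
  assumes "finite J" "J \<noteq> {}"
  shows "\<exists>g\<in>J. \<forall>k\<in>J. (\<forall>i\<in>{1..r}. k i = g i) \<or> (\<exists>i\<in>{1..r}. (\<forall>j\<in>{1..<i}. k j = g j) \<and> k i < g i)"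
proof (induction r)
  case 0
  then show ?case using assms by auto
next
  case (Suc r)
  then obtain g where g: "g \<in> J" "\<And>k. k \<in> J \<Longrightarrow> (\<forall>i\<in>{1..r}. k i = g i) \<or> (\<exists>i\<in>{1..r}. (\<forall>j\<in>{1..<i}. k j = g j) \<and> k i < g i)"
    by blast
  define J' where "J' = {k \<in> J. \<forall>i\<in>{1..r}. k i = g i}"
  have J': "finite ((\<lambda>k. k (Suc r)) ` J')" "(\<lambda>k. k (Suc r)) ` J' \<noteq> {}" using assms g(1) by (auto simp: J'_def)
  obtain h where h: "h \<in> J'" "Max ((\<lambda>k. k (Suc r)) ` J') = h (Suc r)"
    using Max_in[OF J'] by blast
  have h_max: "k (Suc r) \<le> h (Suc r)" if "k \<in> J'" for k
    unfolding h(2)[symmetric] using J'(1) that by (intro Max_ge) auto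
  have hg: "h \<in> J" "\<And>i. i \<in> {1..r} \<Longrightarrow> h i = g i" using h(1) by (auto simp: J'_def)
  show ?case
  proof (intro bexI[of _ h] ballI)
    fix k assume k: "k \<in> J"
    show "(\<forall>i\<in>{1..Suc r}. k i = h i) \<or> (\<exists>i\<in>{1..Suc r}. (\<forall>j\<in>{1..<i}. k j = h j) \<and> k i < h i)"
    proof (cases "k \<in> J'")
      case True
      then have eq: "\<forall>i\<in>{1..r}. k i = h i" using hg(2) by (auto simp: J'_def)
      show ?thesis
      proof (cases "k (Suc r) = h (Suc r)")
        case True
        with eq have "\<forall>i\<in>{1..Suc r}. k i = h i" by (auto simp: le_Suc_eq)
        then show ?thesis ..
      next
        case False
        with h_max[OF True] eq show ?thesis by (intro disjI2 bexI[of _ "Suc r"]) auto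
      qed
    next
      case False
      then obtain i where "i \<in> {1..r}" "\<forall>j\<in>{1..<i}. k j = g j" "k i < g i" using g(2)[OF k] k by (auto simp: J'_def)
      with hg(2) show ?thesis by (intro disjI2 bexI[of _ i]) auto
    qed
  qed (rule hg(1))
qed

text \<open>Extensional functions make each exponent tuple occur once as an index; repeated indices
  for one tuple would destroy independence. In the proof a relation is cleared of denominators,
  normalized in sign and multiplied by a monomial to fit \<open>no_leading_relation\<close>.\<close>

theorem theorem4p1:
  fixes A r :: nat and f :: "nat \<Rightarrow> real fps" and \<beta> :: real
  assumes "A \<ge> 1" and "r \<ge> 2"
    and integral: "\<forall>i\<in>{1..r}. \<forall>n. fps_nth (f i) n \<in> \<int>"
    and nonpolynomial: "\<forall>i\<in>{1..r}. f i \<notin> range fps_of_poly"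
    and bounded: "\<exists>C\<^sub>7>0. \<forall>i\<in>{1..r}. \<forall>n. 0 \<le> fps_nth (f i) n \<and> fps_nth (f i) n \<le> C\<^sub>7"
    and gaps: "\<forall>k :: nat \<Rightarrow> nat.
      (r = 2 \<longrightarrow> k 1 \<le> A - 1) \<and> (r \<ge> 3 \<longrightarrow> k 1 \<le> A) \<longrightarrow>
      (\<lambda>R. R - real (last_below R
          ((\<Sum>h=1..r-2. sumset_power (k h) (fps_supp (f h)))
            + sumset_power (1 + k (r - 1)) (fps_supp (f (r - 1))))))
        \<in> o(\<lambda>R. R / (\<Prod>h=1..r. real (count_below (fps_supp (f h)) R) ^ k h))"
    and growth_first: "\<exists>\<delta>>0.
      (\<lambda>R. real (count_below (fps_supp (f 1)) R)) \<in> o(\<lambda>R. R powr (- \<delta> + 1 / real A))"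
    and growth_next: "\<forall>i\<in>{2..r}. \<forall>\<epsilon>>0.
      (\<lambda>R. real (count_below (fps_supp (f i)) R))
        \<in> o(\<lambda>R. real (count_below (fps_supp (f (i - 1))) R) powr \<epsilon>)"
    and dense_last: "\<exists>C\<^sub>8>0. \<exists>C\<^sub>9>0. \<forall>R\<ge>C\<^sub>9.
      {R..C\<^sub>8 * R} \<inter> real ` fps_supp (f r) \<noteq> {}"
    and "Pisot \<beta> \<or> Salem \<beta>"
  shows "lin_indep_family (rat_adjoin \<beta>) {k \<in> {1..r} \<rightarrow>\<^sub>E (UNIV :: nat set). k 1 \<le> A}
    (\<lambda>k. \<Prod>i=1..r. eval_fps (f i) (inverse \<beta>) ^ k i)"
proof -
  interpret sparse_power_series A r f
  proof
    show "\<exists>C. \<forall>i\<in>{1..r}. \<forall>n. 0 \<le> fps_nth (f i) n \<and> fps_nth (f i) n \<le> C" using bounded by blast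
  qed (use assms in auto)
  have alg: "algebraic_int \<beta>" and beta: "\<beta> > 1" using \<open>Pisot \<beta> \<or> Salem \<beta>\<close> by (auto simp: Pisot_def Salem_def)
  let ?I = "{k \<in> {1..r} \<rightarrow>\<^sub>E (UNIV :: nat set). k 1 \<le> A}"
  let ?v = "\<lambda>k. \<Prod>i=1..r. eval_fps (f i) (inverse \<beta>) ^ k i"
  have eval: "eval_fps (fprod k) (inverse \<beta>) = ?v k" for k
    unfolding fprod_def using beta by (intro eval_fps_prod_power growth) (auto simp: inverse_less_1_iff)
  have False
    if J: "finite J" "J \<subseteq> ?I" and c: "\<And>k. k \<in> J \<Longrightarrow> c k \<in> rat_adjoin \<beta>"
      and sum0: "(\<Sum>k\<in>J. c k * ?v k) = 0" and nz: "\<exists>k\<in>J. c k \<noteq> 0" for J c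
  proof -
    \<comment> \<open>Zero coefficients are dropped so that the one at the lexicographic maximum
      does not vanish.\<close>
    define J0 where "J0 = {k \<in> J. c k \<noteq> 0}"
    have J0: "finite J0" "J0 \<noteq> {}" using J nz by (auto simp: J0_def)
    have sum0': "(\<Sum>k\<in>J0. c k * ?v k) = 0"
      unfolding sum0[symmetric] using J by (intro sum.mono_neutral_left) (auto simp: J0_def)
    obtain m :: int and p where m: "m > 0" and p: "\<And>k. k \<in> J0 \<Longrightarrow> of_int m * c k = poly (of_int_poly (p k)) \<beta>"
      using rat_adjoin_common_denominator[OF alg J0(1), of c] c by (auto simp: J0_def)
    obtain g where g: "g \<in> J0" "\<And>k. k \<in> J0 \<Longrightarrow> (\<forall>i\<in>{1..r}. k i = g i) \<or> (\<exists>i\<in>{1..r}. (\<forall>j\<in>{1..<i}. k j = g j) \<and> k i < g i)"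
      using lexicographic_maximum[OF J0] by blast
    have lex: "\<exists>i\<in>{1..r}. (\<forall>j\<in>{1..<i}. k j = g j) \<and> k i < g i" if "k \<in> J0" "k \<noteq> g" for k
    proof -
      have "k \<in> {1..r} \<rightarrow>\<^sub>E UNIV" "g \<in> {1..r} \<rightarrow>\<^sub>E UNIV" using that g(1) J(2) by (auto simp: J0_def)
      then have "\<not> (\<forall>i\<in>{1..r}. k i = g i)" using that(2) PiE_ext by metis
      with g(2)[OF that(1)] show ?thesis by blast
    qed
    text \<open>Multiplying the relation by a monomial makes the last two exponents of the leading term
      positive. For \<open>r = 2\<close> the exponent of \<open>f 1\<close> is raised only if it vanishes, so it stays at
      most \<open>A\<close>.\<close>
    define e :: "nat \<Rightarrow> nat" where "e i = (if i = r \<or> i = r - 1 \<and> g (r - 1) = 0 then 1 else 0)" for i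
    define sh where "sh k i = k i + e i" for k :: "nat \<Rightarrow> nat" and i
    have inj: "inj_on sh J0" by (auto simp: inj_on_def sh_def fun_eq_iff)
    \<comment> \<open>This sign makes the leading coefficient positive.\<close>
    define s :: int where "s = (if c g > 0 then 1 else - 1)"
    \<comment> \<open>On the image of \<open>sh\<close>, subtracting \<open>e\<close> undoes the
      shift exactly, so the coefficients follow their monomials.\<close>
    define p' where "p' k = Polynomial.smult s (p (\<lambda>i. k i - e i))" for k
    have p'_eval: "poly (of_int_poly (p' (sh k))) \<beta> = of_int s * of_int m * c k" if "k \<in> J0" for k
      using p[OF that] by (simp add: p'_def sh_def hom_distribs)
    show False
    proof (rule no_leading_relation)
      show "Pisot \<beta> \<or> Salem \<beta>" by fact
      show "finite (sh ` J0)" "sh g \<in> sh ` J0" using J0 g by auto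
      show "\<exists>i\<in>{1..r}. (\<forall>j\<in>{1..<i}. k j = sh g j) \<and> k i < sh g i" if "k \<in> sh ` J0" "k \<noteq> sh g" for k
      proof -
        obtain x where x: "x \<in> J0" "k = sh x" using \<open>k \<in> sh ` J0\<close> by blast
        with \<open>k \<noteq> sh g\<close> have "x \<noteq> g" by blast
        then show ?thesis using lex[OF x(1)] unfolding x(2) sh_def by simp
      qed
      show "sh g (r - 1) \<ge> 1" "sh g r \<ge> 1" by (auto simp: sh_def e_def)
      have "g 1 \<le> A" using g(1) J(2) by (auto simp: J0_def)
      then show "sh g 1 \<le> A" using \<open>A \<ge> 1\<close> \<open>r \<ge> 2\<close> by (auto simp: sh_def e_def)
      have "c g \<noteq> 0" using g(1) by (simp add: J0_def)
      then show "poly (of_int_poly (p' (sh g))) \<beta> > 0"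
        unfolding p'_eval[OF g(1)] using m by (auto simp: s_def mult_pos_neg)
      have "(\<Sum>k\<in>sh ` J0. poly (of_int_poly (p' k)) \<beta> * eval_fps (fprod k) (inverse \<beta>))
          = (\<Sum>k\<in>J0. of_int s * of_int m * ?v e * (c k * ?v k))"
        unfolding sum.reindex[OF inj] o_def
      proof (rule sum.cong)
        fix k assume "k \<in> J0"
        have "?v (sh k) = ?v k * ?v e" by (simp add: sh_def power_add prod.distrib)
        then show "poly (of_int_poly (p' (sh k))) \<beta> * eval_fps (fprod (sh k)) (inverse \<beta>)
            = of_int s * of_int m * ?v e * (c k * ?v k)"
          unfolding p'_eval[OF \<open>k \<in> J0\<close>] eval by simp
      qed simp
      also have "\<dots> = 0" using sum0' by (simp flip: sum_distrib_left)
      finally show "(\<Sum>k\<in>sh ` J0. poly (of_int_poly (p' k)) \<beta> * eval_fps (fprod k) (inverse \<beta>)) = 0" .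
    qed
  qed
  then show ?thesis unfolding lin_indep_family_def by blast
qed

end
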